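(* Let $G$ be a path with $n$ vertices and $\kappa:E(G)\to[k]$ a proper edge coloring. If $\mathfrak{G}_\kappa$ is a generalized toggle group, then one of the following holds: (i) $n=\frac{q^d-1}{q-1}$ for a prime power $q$ and some $d\geq2$, and $PGL(d,q)\subseteq\mathfrak{G}_\kappa\subseteq P\Gamma L(d,q)$ (as permutation groups, after identifying $V(G)$ with the points of the $(d-1)$-dimensional projective space over $\mathbb{F}_q$); (ii) $\mathfrak{G}_\kappa\cong M_{23}$, the Mathieu group; (iii) $\mathfrak{G}_\kappa\cong S_n$.
   Context: A proper edge coloring of $G$ on $k$ colors is a surjective map $\kappa:E(G)\to[k]$ such that edges sharing a vertex receive different colors. For $a\in[k]$, $\tau_a\in S_{V(G)}$ is the product of the transpositions $(i,j)$ over all edges $\{i,j\}$ colored $a$, and $\mathfrak{G}_\kappa\le S_{V(G)}$ is generated by $\tau_1,\dots,\tau_k$. Toggles: for a finite set $E$ and $L\subseteq 2^E$, $t_e$ ($e\in E$) is the permutation of $L$ with $t_e(X)=X\cup\{e\}$ if $e\notin X$ and $X\cup\{e\}\in L$, $t_e(X)=X\setminus\{e\}$ if $e\in X$ and $X\setminus\{e\}\in L$, and $t_e(X)=X$ otherwise. "$\mathfrak{G}_\kappa$ is a generalized toggle group" means: there exist a finite set $E$, $L\subseteq 2^E$, a bijection $\varphi:V(G)\to L$ and an injective map $c:[k]\to E$ such that for all distinct $u,v\in V(G)$ and $a\in[k]$, $\{u,v\}$ is an edge colored $a$ iff the symmetric difference of $\varphi(u)$ and $\varphi(v)$ is $\{c(a)\}$,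 and every $e\in E$ with $t_e\neq\mathrm{id}$ is in the image of $c$. *)

theory Defs
  imports
    "HOL-Algebra.Sym_Groups"
    "HOL-Algebra.QuotRing"
    "HOL-Library.FuncSet"
    "HOL-Number_Theory.Prime_Powers"
begin

section \<open>Paths and proper edge colorings\<close>

text \<open>A finite simple graph is given by its vertex set and its set of two-element edges.\<close>

definition path_graph :: "'v set \<Rightarrow> 'v set set \<Rightarrow> nat \<Rightarrow> bool" where
  "path_graph V E n \<longleftrightarrow>
     (\<exists>vs. vs \<noteq> [] \<and> length vs = n \<and> distinct vs \<and> set vs = V \<and>
           E = {{vs ! i, vs ! Suc i} | i. Suc i < n})"

definition proper_edge_coloring :: "'v set set \<Rightarrow> nat \<Rightarrow> ('v set \<Rightarrow> nat) \<Rightarrow> bool" where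
  "proper_edge_coloring E k \<kappa> \<longleftrightarrow>
     \<kappa> ` E = {1..k} \<and>
     (\<forall>e\<in>E. \<forall>f\<in>E. e \<noteq> f \<and> e \<inter> f \<noteq> {} \<longrightarrow> \<kappa> e \<noteq> \<kappa> f)"


section \<open>The permutation group of an edge coloring\<close>

text \<open>
  The symmetric group on an arbitrary set. Permutations of \<open>V\<close> are total functions that
  are the identity outside \<open>V\<close>, so that \<open>sym_on {1..n}\<close> is \<^const>\<open>sym_group\<close>.
\<close>

definition sym_on :: "'v set \<Rightarrow> ('v \<Rightarrow> 'v) monoid" where
  "sym_on V = \<lparr>carrier = {p. p permutes V}, mult = (\<circ>), one = id\<rparr>"

definition edge_transposition :: "'v set \<Rightarrow> 'v \<Rightarrow> 'v" where
  "edge_transposition e = (THE p. \<exists>i j. e = {i, j} \<and> p = transpose i j)"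

text \<open>
  The product over the edges of color \<open>a\<close>. In a proper coloring these edges are disjoint,
  so the transpositions commute and the fold does not depend on the order of the factors
  (see \<open>tau_edge\<close> and \<open>tau_fixed\<close> below).
\<close>

definition tau :: "'v set set \<Rightarrow> ('v set \<Rightarrow> nat) \<Rightarrow> nat \<Rightarrow> 'v \<Rightarrow> 'v" where
  "tau E \<kappa> a = Finite_Set.fold (\<lambda>e p. edge_transposition e \<circ> p) id {e \<in> E. \<kappa> e = a}"

definition coloring_group ::
  "'v set \<Rightarrow> 'v set set \<Rightarrow> nat \<Rightarrow> ('v set \<Rightarrow> nat) \<Rightarrow> ('v \<Rightarrow> 'v) monoid" where
  "coloring_group V E k \<kappa> =
     (sym_on V)\<lparr>carrier := generate (sym_on V) (tau E \<kappa> ` {1..k})\<rparr>"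


section \<open>Toggles\<close>

text \<open>
  As a permutation of \<open>L\<close>, a toggle is the identity outside \<open>L\<close>; hence it is the identity
  permutation of \<open>L\<close> iff it equals \<^const>\<open>id\<close>.
\<close>

definition toggle :: "'e set set \<Rightarrow> 'e \<Rightarrow> 'e set \<Rightarrow> 'e set" where
  "toggle L e X =
     (if X \<in> L \<and> e \<notin> X \<and> insert e X \<in> L then insert e X
      else if X \<in> L \<and> e \<in> X \<and> X - {e} \<in> L then X - {e}
      else X)"

text \<open>
  The type argument is the type from which the ground set \<open>S\<close> is drawn. It is left
  arbitrary since a formula of HOL cannot quantify over types.
\<close>

definition generalized_toggle_group ::
  "'e itself \<Rightarrow> 'v set \<Rightarrow> 'v set set \<Rightarrow> nat \<Rightarrow> ('v set \<Rightarrow> nat) \<Rightarrow> bool" where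
  "generalized_toggle_group (_ :: 'e itself) V E k \<kappa> \<longleftrightarrow>
     (\<exists>(S :: 'e set) L \<phi> c.
        finite S \<and> L \<subseteq> Pow S \<and> bij_betw \<phi> V L \<and>
        c ` {1..k} \<subseteq> S \<and> inj_on c {1..k} \<and>
        (\<forall>u\<in>V. \<forall>v\<in>V. u \<noteq> v \<longrightarrow>
           (\<forall>a\<in>{1..k}. {u, v} \<in> E \<and> \<kappa> {u, v} = a \<longleftrightarrow> sym_diff (\<phi> u) (\<phi> v) = {c a})) \<and>
        (\<forall>e\<in>S. toggle L e \<noteq> id \<longrightarrow> e \<in> c ` {1..k}))"


section \<open>Projective linear and semilinear groups\<close>

text \<open>
  The vector space of \<open>d\<close>-tuples over a field \<open>F\<close>, as extensional functions on \<open>{..<d}\<close>.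
\<close>

definition fvec :: "('a, 'm) ring_scheme \<Rightarrow> nat \<Rightarrow> (nat \<Rightarrow> 'a) set" where
  "fvec F d = {..<d} \<rightarrow>\<^sub>E carrier F"

definition fvec_add ::
  "('a, 'm) ring_scheme \<Rightarrow> nat \<Rightarrow> (nat \<Rightarrow> 'a) \<Rightarrow> (nat \<Rightarrow> 'a) \<Rightarrow> nat \<Rightarrow> 'a" where
  "fvec_add F d v w = (\<lambda>i\<in>{..<d}. v i \<oplus>\<^bsub>F\<^esub> w i)"

definition fvec_smult ::
  "('a, 'm) ring_scheme \<Rightarrow> nat \<Rightarrow> 'a \<Rightarrow> (nat \<Rightarrow> 'a) \<Rightarrow> nat \<Rightarrow> 'a" where
  "fvec_smult F d c v = (\<lambda>i\<in>{..<d}. c \<otimes>\<^bsub>F\<^esub> v i)"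

definition fvec_zero :: "('a, 'm) ring_scheme \<Rightarrow> nat \<Rightarrow> nat \<Rightarrow> 'a" where
  "fvec_zero F d = (\<lambda>i\<in>{..<d}. \<zero>\<^bsub>F\<^esub>)"

text \<open>
  The points of the projective space of dimension \<open>d - 1\<close>: the one-dimensional
  subspaces, each represented by its set of vectors.
\<close>

definition proj_points :: "('a, 'm) ring_scheme \<Rightarrow> nat \<Rightarrow> (nat \<Rightarrow> 'a) set set" where
  "proj_points F d =
     {(\<lambda>c. fvec_smult F d c v) ` carrier F | v. v \<in> fvec F d \<and> v \<noteq> fvec_zero F d}"

definition semilinear_bij ::
  "('a, 'm) ring_scheme \<Rightarrow> nat \<Rightarrow> ('a \<Rightarrow> 'a) \<Rightarrow> ((nat \<Rightarrow> 'a) \<Rightarrow> (nat \<Rightarrow> 'a)) \<Rightarrow> bool" where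
  "semilinear_bij F d \<sigma> f \<longleftrightarrow>
     bij_betw f (fvec F d) (fvec F d) \<and>
     (\<forall>v\<in>fvec F d. \<forall>w\<in>fvec F d. f (fvec_add F d v w) = fvec_add F d (f v) (f w)) \<and>
     (\<forall>c\<in>carrier F. \<forall>v\<in>fvec F d. f (fvec_smult F d c v) = fvec_smult F d (\<sigma> c) (f v))"

text \<open>
  The groups PGL and P\<open>\<Gamma>\<close>L are taken as permutation groups of the projective points: they consist
  of the permutations induced by linear, respectively semilinear, bijections of the
  vector space, the latter with respect to any automorphism of the field.
\<close>

definition PGL :: "('a, 'm) ring_scheme \<Rightarrow> nat \<Rightarrow> ((nat \<Rightarrow> 'a) set \<Rightarrow> (nat \<Rightarrow> 'a) set) set" where
  "PGL F d = {restrict_id (image f) (proj_points F d) | f. semilinear_bij F d id f}"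

definition PGammaL :: "('a, 'm) ring_scheme \<Rightarrow> nat \<Rightarrow> ((nat \<Rightarrow> 'a) set \<Rightarrow> (nat \<Rightarrow> 'a) set) set" where
  "PGammaL F d =
     {restrict_id (image f) (proj_points F d) | f \<sigma>. \<sigma> \<in> ring_iso F F \<and> semilinear_bij F d \<sigma> f}"


section \<open>The Mathieu group on 23 points\<close>

text \<open>
  The binary Golay code of length 23, realised as the quadratic residue code modulo 23: the
  span over the field with two elements of the cyclic shifts of the set of nonzero squares
  modulo 23. A codeword is identified with its support, so that addition becomes symmetric
  difference. This is the perfect code with parameters [23,12,7], and the Mathieu group on 23
  points is its automorphism group.
\<close>

definition squares_mod_23 :: "nat set" where
  "squares_mod_23 = {x ^ 2 mod 23 | x. 0 < x \<and> x < 23}"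

inductive_set golay_code :: "nat set set" where
  empty: "{} \<in> golay_code"
| add: "C \<in> golay_code \<Longrightarrow> sym_diff ((\<lambda>r. (r + s) mod 23) ` squares_mod_23) C \<in> golay_code"

definition M23 :: "(nat \<Rightarrow> nat) monoid" where
  "M23 = (sym_on {..<23})
     \<lparr>carrier := {p. p permutes {..<23} \<and> (\<forall>C\<in>golay_code. p ` C \<in> golay_code)}\<rparr>"


section \<open>Basic facts\<close>

lemma edge_transposition_eq: "edge_transposition {i, j} = transpose i j"
  unfolding edge_transposition_def
  by (rule the_equality) (auto simp: doubleton_eq_iff transpose_commute)

lemma sym_on_group: "group (sym_on V)"
proof (rule groupI)
  fix p assume "p \<in> carrier (sym_on V)"
  then show "\<exists>q\<in>carrier (sym_on V). q \<otimes>\<^bsub>sym_on V\<^esub> p = \<one>\<^bsub>sym_on V\<^esub>"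
    using permutes_inv permutes_inv_o(2) by (fastforce simp: sym_on_def)
qed (auto simp: sym_on_def permutes_compose permutes_id comp_assoc)

lemma sym_on_sym_group: "sym_on {1..n} = sym_group n"
  by (simp add: sym_on_def sym_group_def)

lemma path_graph_finite:
  assumes "path_graph V E n"
  shows "finite V" and "finite E"
proof -
  obtain vs where vs: "set vs = V" "E = {{vs ! i, vs ! Suc i} | i. Suc i < n}"
    using assms unfolding path_graph_def by blast
  show "finite V" using vs by auto
  have "E \<subseteq> (\<lambda>i. {vs ! i, vs ! Suc i}) ` {..<n}" using vs by auto
  then show "finite E" by (rule finite_subset) simp
qed

lemma path_graph_edge:
  assumes "path_graph V E n" and "e \<in> E"
  obtains i j where "e = {i, j}" "i \<noteq> j" "i \<in> V" "j \<in> V"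
proof -
  obtain vs where vs: "length vs = n" "distinct vs" "set vs = V"
      "E = {{vs ! i, vs ! Suc i} | i. Suc i < n}"
    using assms unfolding path_graph_def by blast
  then obtain i where i: "Suc i < n" "e = {vs ! i, vs ! Suc i}"
    using assms(2) by auto
  show thesis
    by (rule that[OF i(2)]) (use vs i in \<open>auto simp: nth_eq_iff_index_eq\<close>)
qed

lemma fold_transposition:
  fixes A :: "'v set set"
  assumes "finite A" and "\<And>e. e \<in> A \<Longrightarrow> \<exists>i j. e = {i, j} \<and> i \<noteq> j"
    and "\<And>e f. e \<in> A \<Longrightarrow> f \<in> A \<Longrightarrow> e \<noteq> f \<Longrightarrow> e \<inter> f = {}"
  defines "P \<equiv> Finite_Set.fold (\<lambda>e p. edge_transposition e \<circ> p) id A"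
  shows "\<And>u v. {u, v} \<in> A \<Longrightarrow> P u = v" and "\<And>u. u \<notin> \<Union>A \<Longrightarrow> P u = u"
proof -
  interpret comp_fun_commute_on A "\<lambda>e (p :: 'v \<Rightarrow> 'v). edge_transposition e \<circ> p"
  proof
    fix e f assume ef: "e \<in> A" "f \<in> A"
    obtain i j k l where ij: "e = {i, j}" and kl: "f = {k, l}"
      using assms(2) ef by meson
    have "edge_transposition f \<circ> edge_transposition e = edge_transposition e \<circ> edge_transposition f"
    proof (cases "e = f")
      case False
      then have "{i, j} \<inter> {k, l} = {}" using assms(3) ef ij kl by blast
      then show ?thesis
        unfolding ij kl edge_transposition_eq by (auto simp: fun_eq_iff transpose_def)
    qed simp
    then show "(\<lambda>p. edge_transposition f \<circ> p) \<circ> (\<lambda>p. edge_transposition e \<circ> p) =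
        (\<lambda>p. edge_transposition e \<circ> p) \<circ> (\<lambda>p :: 'v \<Rightarrow> 'v. edge_transposition f \<circ> p)"
      by (simp add: fun_eq_iff)
  qed
  have "(\<forall>u v. {u, v} \<in> B \<longrightarrow> Finite_Set.fold (\<lambda>e p. edge_transposition e \<circ> p) id B u = v) \<and>
        (\<forall>u. u \<notin> \<Union>B \<longrightarrow> Finite_Set.fold (\<lambda>e p. edge_transposition e \<circ> p) id B u = u)"
    if "finite B" "B \<subseteq> A" for B
    using that
  proof (induction B rule: finite_induct)
    case (insert e B)
    let ?P = "Finite_Set.fold (\<lambda>e p. edge_transposition e \<circ> p) id B"
    have rec: "Finite_Set.fold (\<lambda>e p. edge_transposition e \<circ> p) id (insert e B)
        = edge_transposition e \<circ> ?P"
      using insert by (intro fold_insert) auto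
    obtain i j where ij: "e = {i, j}" "i \<noteq> j" using assms(2) insert by blast
    have disj: "e \<inter> f = {}" if "f \<in> B" for f
      using that insert assms(3)[of e f] by auto
    have fixd: "edge_transposition e x = x" if "x \<notin> e" for x
      using that ij by (auto simp: edge_transposition_eq transpose_def)
    have swap: "edge_transposition e u = v" if "{u, v} = e" for u v
      using that edge_transposition_eq[of u v] by auto
    have IH1: "?P u = v" if "{u, v} \<in> B" for u v using insert.IH insert.prems that by blast
    have IH2: "?P u = u" if "u \<notin> \<Union>B" for u using insert.IH insert.prems that by blast
    have 1: "(edge_transposition e \<circ> ?P) u = v" if uv: "{u, v} \<in> insert e B" for u v
    proof (cases "{u, v} = e")
      case True
      then have "u \<in> e" by auto
      then have "u \<notin> \<Union>B" using disj by blast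
      then show ?thesis using IH2 swap True by simp
    next
      case False
      then have "{u, v} \<in> B" using uv by auto
      moreover from this have "v \<notin> e" using disj[of "{u, v}"] by auto
      ultimately show ?thesis using IH1 fixd by simp
    qed
    have 2: "(edge_transposition e \<circ> ?P) u = u" if "u \<notin> \<Union>(insert e B)" for u
      using that IH2 fixd by simp
    show ?case unfolding rec using 1 2 by blast
  qed auto
  from this[OF assms(1) subset_refl] show "\<And>u v. {u, v} \<in> A \<Longrightarrow> P u = v"
    and "\<And>u. u \<notin> \<Union>A \<Longrightarrow> P u = u"
    unfolding P_def by blast+
qed

lemma
  assumes "path_graph V E n" and "proper_edge_coloring E k \<kappa>"
  shows tau_edge: "\<And>u v. {u, v} \<in> E \<Longrightarrow> \<kappa> {u, v} = a \<Longrightarrow> tau E \<kappa> a u = v"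
    and tau_fixed: "\<And>u. (\<And>e. e \<in> E \<Longrightarrow> \<kappa> e = a \<Longrightarrow> u \<notin> e) \<Longrightarrow> tau E \<kappa> a u = u"
proof -
  let ?A = "{e \<in> E. \<kappa> e = a}"
  have fin: "finite ?A" using path_graph_finite[OF assms(1)] by simp
  have ed: "\<exists>i j. e = {i, j} \<and> i \<noteq> j" if "e \<in> ?A" for e
    using that path_graph_edge[OF assms(1), of e] by (metis (lifting) mem_Collect_eq)
  have disj: "e \<inter> f = {}" if "e \<in> ?A" "f \<in> ?A" "e \<noteq> f" for e f
    using that assms(2) unfolding proper_edge_coloring_def by blast
  note F = fold_transposition[OF fin ed disj, folded tau_def]
  show "\<And>u v. {u, v} \<in> E \<Longrightarrow> \<kappa> {u, v} = a \<Longrightarrow> tau E \<kappa> a u = v"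
    by (rule F(1)) auto
  show "\<And>u. (\<And>e. e \<in> E \<Longrightarrow> \<kappa> e = a \<Longrightarrow> u \<notin> e) \<Longrightarrow> tau E \<kappa> a u = u"
    by (rule F(2)) auto
qed

lemma tau_permutes:
  assumes G: "path_graph V E n" and \<kappa>: "proper_edge_coloring E k \<kappa>"
  shows "tau E \<kappa> a permutes V"
proof -
  have invol: "tau E \<kappa> a (tau E \<kappa> a u) = u" for u
  proof (cases "\<exists>e\<in>E. \<kappa> e = a \<and> u \<in> e")
    case True
    then obtain e where e: "e \<in> E" "\<kappa> e = a" "u \<in> e" by blast
    then obtain v where v: "e = {u, v}" using path_graph_edge[OF G e(1)]
      by (metis insert_commute insertE singletonD)
    have "tau E \<kappa> a u = v" using e v by (intro tau_edge[OF G \<kappa>]) auto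
    moreover have "tau E \<kappa> a v = u"
      using e v by (intro tau_edge[OF G \<kappa>]) (auto simp: insert_commute)
    ultimately show ?thesis by simp
  next
    case False
    then have "tau E \<kappa> a u = u" by (intro tau_fixed[OF G \<kappa>]) auto
    then show ?thesis by simp
  qed
  have "tau E \<kappa> a u = u" if "u \<notin> V" for u
    using that by (intro tau_fixed[OF G \<kappa>]) (auto elim: path_graph_edge[OF G])
  moreover have "bij (tau E \<kappa> a)" using invol by (rule involuntory_imp_bij)
  ultimately show ?thesis by (auto simp: permutes_def bij_iff)
qed

lemma coloring_group_subgroup:
  assumes "path_graph V E n" and "proper_edge_coloring E k \<kappa>"
  shows "subgroup (carrier (coloring_group V E k \<kappa>)) (sym_on V)"
  using group.generate_is_subgroup[OF sym_on_group, of "tau E \<kappa> ` {1..k}" V] tau_permutes[OF assms]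
  by (auto simp: coloring_group_def sym_on_def)

lemma PGL_subset_PGammaL:
  assumes "ring F"
  shows "PGL F d \<subseteq> PGammaL F d"
proof -
  have "id \<in> ring_iso F F" by (auto simp: ring_iso_def ring_hom_def)
  then show ?thesis unfolding PGL_def PGammaL_def by blast
qed

end

theory Submission
  imports Defs
begin

text \<open>
  The colored path is an induced path \<open>x\<^sub>0, \<dots>, x\<^sub>m\<close> in the cube of all subsets, on which the
  generators act as toggles, and the group turns out to be the full symmetric group. A translation
  of the cube (symmetric difference with a fixed set) that preserves a segment of the path acts on
  it as the reversal without fixed points, so the segment is a single edge. Hence distinct
  translates, inside the path, of a segment with at least three vertices are disjoint and
  nonadjacent. By induction on its length, every double transposition of a segment, applied
  simultaneously on all translates of the segment, belongs to the group: for two segments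
  that overlap in all but one vertex, translates by different sets share at most one vertex, where
  the commutator is a three-cycle; its cube therefore lives on the translates of the union only.
  The whole path has a single translate, so the group contains all even permutations. Since
  \<open>x\<^sub>0 \<noteq> x\<^sub>m\<close>, some color occurs an odd number of times, and its generator is odd.
\<close>

section \<open>Induced paths in the cube\<close>

definition xor :: "'e set \<Rightarrow> 'e set \<Rightarrow> 'e set" (infixl "\<triangle>" 65) where
  "A \<triangle> B = sym_diff A B"

lemma xor_ac: "A \<triangle> B \<triangle> C = A \<triangle> (B \<triangle> C)" "A \<triangle> B = B \<triangle> A" "A \<triangle> (B \<triangle> C) = B \<triangle> (A \<triangle> C)"
  by (auto simp: xor_def)

lemma xor_cancel [simp]:
  "A \<triangle> A = {}" "A \<triangle> {} = A" "{} \<triangle> A = A" "A \<triangle> (A \<triangle> B) = B" "A \<triangle> B \<triangle> B = A"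
  by (auto simp: xor_def)

lemma xor_right_cancel [simp]: "A \<triangle> S = B \<triangle> S \<longleftrightarrow> A = B"
  by (metis xor_cancel(5))

lemma xor_left_cancel [simp]: "S \<triangle> A = S \<triangle> B \<longleftrightarrow> A = B"
  by (metis xor_cancel(4))

lemma xor_eq_iff: "A \<triangle> B = C \<longleftrightarrow> A = C \<triangle> B"
  by (metis xor_cancel(5))

lemma xor_xor [simp]: "(A \<triangle> S) \<triangle> (B \<triangle> S) = A \<triangle> B"
  by (auto simp: xor_def)

lemma xor_shift: "A \<triangle> S \<triangle> (S \<triangle> S') = A \<triangle> S'" "A \<triangle> S' \<triangle> (S \<triangle> S') = A \<triangle> S"
  by (auto simp: xor_def)

lemma xor_eq_empty [simp]: "A \<triangle> B = {} \<longleftrightarrow> A = B"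
  by (auto simp: xor_def)

section \<open>Induced paths of the cube and the translates of their segments\<close>

locale snake =
  fixes f :: "nat \<Rightarrow> 'e set" and m :: nat
  assumes inj: "inj_on f {..m}"
    and step: "\<And>i. i < m \<Longrightarrow> \<exists>c. f i \<triangle> f (Suc i) = {c}"
    and chordless: "\<And>i j c. i \<le> m \<Longrightarrow> j \<le> m \<Longrightarrow> f i \<triangle> f j = {c} \<Longrightarrow> j = Suc i \<or> i = Suc j"
begin

definition X :: "'e set set" where "X = f ` {..m}"

text \<open>Each \<open>S\<close> is a translation of the cube; these are the ones that carry
  \<open>U\<close> into the path.\<close>

definition occ :: "'e set set \<Rightarrow> 'e set set" where
  "occ U = {S. \<forall>x\<in>U. x \<triangle> S \<in> X}"

lemma f_eq_iff [simp]: "i \<le> m \<Longrightarrow> j \<le> m \<Longrightarrow> f i = f j \<longleftrightarrow> i = j"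
  using inj by (auto simp: inj_on_def)

lemma f_in_X: "i \<le> m \<Longrightarrow> f i \<in> X"
  by (auto simp: X_def)

lemma XE: assumes "x \<in> X" obtains i where "i \<le> m" "x = f i"
  using assms by (auto simp: X_def)

text \<open>A translation preserves adjacency in the cube, so it carries a segment to a walk in the
  path. Injectivity forbids turning back, hence the walk runs monotonically, forward or
  backward.\<close>

lemma occ_image:
  assumes "i + L \<le> m" "S \<in> occ (f ` {i..i+L})"
  shows "\<exists>j. j + L \<le> m \<and> ((\<forall>t\<le>L. f (i + t) \<triangle> S = f (j + t)) \<or>
                            (\<forall>t\<le>L. f (i + t) \<triangle> S = f (j + L - t)))"
  using assms
proof (induction L)
  case 0
  then show ?case by (auto simp: occ_def X_def)
next
  case (Suc L)
  have "S \<in> occ (f ` {i..i+L})" using Suc.prems by (auto simp: occ_def)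
  then obtain j where j: "j + L \<le> m"
    and e: "(\<forall>t\<le>L. f (i + t) \<triangle> S = f (j + t)) \<or> (\<forall>t\<le>L. f (i + t) \<triangle> S = f (j + L - t))"
    using Suc by auto
  have "f (i + Suc L) \<triangle> S \<in> X" using Suc.prems(2) by (auto simp: occ_def)
  then obtain k where k: "k \<le> m" "f (i + Suc L) \<triangle> S = f k" by (auto elim: XE)
  obtain c where "f (i + L) \<triangle> f (i + Suc L) = {c}" using step[of "i+L"] Suc.prems(1) by auto
  then have c: "(f (i + L) \<triangle> S) \<triangle> f k = {c}" by (simp flip: k(2))
  have kn: "f k \<noteq> f (i + t) \<triangle> S" if "t \<le> L" for t
    using that Suc.prems(1) by (simp flip: k(2))
  from e show ?case
  proof
    assume F: "\<forall>t\<le>L. f (i + t) \<triangle> S = f (j + t)"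
    then have "k = Suc (j + L) \<or> j + L = Suc k" using chordless[OF j k(1), of c] c by simp
    \<comment> \<open>With \<open>L = 0\<close> the direction is still open, so a step down starts
      the backward case; with \<open>L > 0\<close> it would turn back, against
      \<open>kn\<close>.\<close>
    then consider "k = Suc (j + L)" | "L = 0" "j = Suc k" | "L > 0" "k = j + (L - 1)" by force
    then show ?case
    proof cases
      case 1
      then show ?thesis using F k by (intro exI[of _ j]) (auto simp: le_Suc_eq)
    next
      case 2
      then show ?thesis using F k j by (intro exI[of _ k]) (auto simp: le_Suc_eq)
    next
      case 3
      then show ?thesis using kn[of "L-1"] F[rule_format, of "L-1"] by simp
    qed
  next
    assume F: "\<forall>t\<le>L. f (i + t) \<triangle> S = f (j + L - t)"
    then have "k = Suc j \<or> j = Suc k" using chordless[of j k c] j k(1) c by simp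
    then consider "j = Suc k" | "L = 0" "k = Suc j" | "L > 0" "k = j + L - (L - 1)" by force
    then show ?case
    proof cases
      case 1
      then show ?thesis using F k j by (intro exI[of _ k]) (auto simp: le_Suc_eq)
    next
      case 2
      then show ?thesis using F k j by (intro exI[of _ j]) (auto simp: le_Suc_eq)
    next
      case 3
      then show ?thesis using kn[of "L-1"] F[rule_format, of "L-1"] by simp
    qed
  qed
qed

text \<open>Later arguments need only the index interval and the unordered pair of ends, whatever
  the direction.\<close>

lemma occ_image_set:
  assumes "i + L \<le> m" "S \<in> occ (f ` {i..i+L})"
  obtains j where "j + L \<le> m" "(\<lambda>x. x \<triangle> S) ` f ` {i..i+L} = f ` {j..j+L}"
    "{f i \<triangle> S, f (i + L) \<triangle> S} = {f j, f (j + L)}"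
proof -
  obtain j where j: "j + L \<le> m" and e: "(\<forall>t\<le>L. f (i + t) \<triangle> S = f (j + t)) \<or>
                            (\<forall>t\<le>L. f (i + t) \<triangle> S = f (j + L - t))"
    using occ_image[OF assms] by blast
  have I: "{k..k+L} = (\<lambda>t. k + t) ` {..L}" for k :: nat
    by (simp add: image_add_atLeastAtMost atMost_atLeast0)
  have R: "{k..k+L} = (\<lambda>t. k + L - t) ` {..L}" for k :: nat
  proof -
    have "x \<in> (\<lambda>t. k + L - t) ` {..L}" if "x \<in> {k..k+L}" for x
      using that by (intro image_eqI[of _ _ "k + L - x"]) auto
    then show ?thesis by auto
  qed
  have "(\<lambda>x. x \<triangle> S) ` f ` {i..i+L} = f ` {j..j+L}"
    using e
  proof
    assume "\<forall>t\<le>L. f (i + t) \<triangle> S = f (j + t)"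
    then show ?thesis unfolding I image_image by (intro image_cong) auto
  next
    assume "\<forall>t\<le>L. f (i + t) \<triangle> S = f (j + L - t)"
    then show ?thesis unfolding I[of i] R[of j] image_image by (intro image_cong) auto
  qed
  moreover have "{f i \<triangle> S, f (i + L) \<triangle> S} = {f j, f (j + L)}"
    using e
  proof
    assume "\<forall>t\<le>L. f (i + t) \<triangle> S = f (j + t)"
    then have "f (i + 0) \<triangle> S = f (j + 0)" "f (i + L) \<triangle> S = f (j + L)" by blast+
    then show ?thesis by simp
  next
    assume "\<forall>t\<le>L. f (i + t) \<triangle> S = f (j + L - t)"
    then have "f (i + 0) \<triangle> S = f (j + L - 0)" "f (i + L) \<triangle> S = f (j + L - L)" by blast+
    then show ?thesis by (simp add: insert_commute)
  qed
  ultimately show thesis by (rule that[OF j])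
qed

text \<open>A nonempty \<open>T\<close> fixes no vertex, so it must reverse the segment, and the
  number of edges is odd because a middle vertex would be fixed. The ends of the middle edge are
  swapped, so \<open>T\<close> is a singleton; the ends of the segment also differ by
  \<open>T\<close> and are therefore adjacent.\<close>

lemma segment_invariant:
  assumes "a \<le> b" "b \<le> m" "T \<noteq> {}" and inv: "\<And>x. x \<in> f ` {a..b} \<Longrightarrow> x \<triangle> T \<in> f ` {a..b}"
  shows "b = Suc a" "f a \<triangle> f b = T"
proof -
  define L where "L = b - a"
  have b: "b = a + L" using assms(1) by (simp add: L_def)
  have "T \<in> occ (f ` {a..a+L})"
    using inv assms(2) unfolding occ_def X_def b by fastforce
  then obtain j where j: "j + L \<le> m" and e: "(\<forall>t\<le>L. f (a + t) \<triangle> T = f (j + t)) \<or>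
                            (\<forall>t\<le>L. f (a + t) \<triangle> T = f (j + L - t))"
    using occ_image[of a L T] assms(2) b by blast
  have m: "p \<in> {a..a+L}" if "x \<in> {a..a+L}" "f x \<triangle> T = f p" "p \<le> m" for x p
  proof -
    have "f p \<in> f ` {a..a+L}" using inv[of "f x"] that unfolding b by auto
    then show ?thesis using that assms(2) b by auto
  qed
  have "j \<in> {a..a+L} \<and> j + L \<in> {a..a+L}"
    using e
  proof
    assume "\<forall>t\<le>L. f (a + t) \<triangle> T = f (j + t)"
    then have "f (a + 0) \<triangle> T = f (j + 0)" "f (a + L) \<triangle> T = f (j + L)" by blast+
    then show ?thesis using m[of "a + 0" j] m[of "a + L" "j + L"] j by simp
  next
    assume "\<forall>t\<le>L. f (a + t) \<triangle> T = f (j + L - t)"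
    then have "f (a + 0) \<triangle> T = f (j + L - 0)" "f (a + L) \<triangle> T = f (j + L - L)" by blast+
    then show ?thesis using m[of "a + 0" "j + L"] m[of "a + L" j] j by simp
  qed
  then have ja: "j = a" by auto
  have nf: "f x \<triangle> T \<noteq> f x" for x using assms(3) by (metis xor_cancel(2) xor_left_cancel)
  have r: "f (a + t) \<triangle> T = f (a + L - t)" if "t \<le> L" for t
    using e that nf[of a] ja by (metis le0 Nat.add_0_right)
  have ab: "f a \<triangle> f b = T" using r[of 0] b by (simp add: xor_eq_iff xor_ac)
  have "odd L"
  proof
    assume "even L"
    then have "a + L - L div 2 = a + L div 2" by auto
    then show False using r[of "L div 2"] nf by simp
  qed
  then obtain h where h: "L = Suc (2 * h)" by (auto elim: oddE)
  have "f (a + h) \<triangle> T = f (Suc (a + h))" using r[of h] h by (simp add: mult_2)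
  then have "f (a + h) \<triangle> f (Suc (a + h)) = T" by (metis xor_cancel(4))
  then obtain c where "T = {c}" using step[of "a + h"] h assms(2) b by auto
  then have "b = Suc a \<or> a = Suc b" using chordless[of a b c] ab assms by auto
  then show "b = Suc a" using assms(1) by auto
  show "f a \<triangle> f b = T" by (rule ab)
qed

text \<open>The two translates occupy index intervals that overlap or are adjacent, so their union
  is a segment. \<open>S \<triangle> S1\<close> exchanges the translates and preserves the union,
  which by \<open>segment_invariant\<close> is a single edge.\<close>

lemma occ_touch:
  assumes "i + L \<le> m" "L \<ge> 1" and S: "S \<in> occ (f ` {i..i+L})" "S1 \<in> occ (f ` {i..i+L})" "S \<noteq> S1"
    and x: "x \<in> f ` {i..i+L}" "y \<in> f ` {i..i+L}"
    and t: "x \<triangle> S = y \<triangle> S1 \<or> (\<exists>c. (x \<triangle> S) \<triangle> (y \<triangle> S1) = {c})"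
  shows "L = 1 \<and> S \<triangle> S1 = f i \<triangle> f (Suc i)"
proof -
  let ?M = "f ` {i..i+L}"
  obtain j where j: "j + L \<le> m" "(\<lambda>x. x \<triangle> S) ` ?M = f ` {j..j+L}"
    "{f i \<triangle> S, f (i + L) \<triangle> S} = {f j, f (j + L)}" using occ_image_set assms by metis
  obtain k where k: "k + L \<le> m" "(\<lambda>x. x \<triangle> S1) ` ?M = f ` {k..k+L}" using occ_image_set assms by metis
  obtain p where p: "p \<in> {j..j+L}" "x \<triangle> S = f p" using x(1) j(2) by (metis (no_types, lifting) imageE imageI)
  obtain q where q: "q \<in> {k..k+L}" "y \<triangle> S1 = f q" using x(2) k(2) by (metis (no_types, lifting) imageE imageI)
  have pq: "p \<le> Suc q \<and> q \<le> Suc p"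
    using t chordless[of p q] p q j(1) k(1) by force
  define T where "T = S \<triangle> S1"
  have T: "T \<noteq> {}" using S(3) by (simp add: T_def)
  define a b where "a = min j k" and "b = max j k + L"
  have un: "{a..b} = {j..j+L} \<union> {k..k+L}"
    using pq p(1) q(1) assms(2) unfolding a_def b_def by (auto simp: min_def max_def)
  have inv: "u \<triangle> T \<in> f ` {a..b}" if "u \<in> f ` {a..b}" for u
  proof -
    have "u \<in> (\<lambda>x. x \<triangle> S) ` ?M \<or> u \<in> (\<lambda>x. x \<triangle> S1) ` ?M" using that unfolding un image_Un j(2) k(2) by simp
    then have "u \<triangle> T \<in> (\<lambda>x. x \<triangle> S1) ` ?M \<or> u \<triangle> T \<in> (\<lambda>x. x \<triangle> S) ` ?M"
    proof (elim disjE)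
      assume "u \<in> (\<lambda>x. x \<triangle> S) ` ?M"
      then obtain z where "u = z \<triangle> S" "z \<in> ?M" by blast
      moreover from this have "u \<triangle> T = z \<triangle> S1" by (simp only: T_def xor_shift)
      ultimately show ?thesis by blast
    next
      assume "u \<in> (\<lambda>x. x \<triangle> S1) ` ?M"
      then obtain z where "u = z \<triangle> S1" "z \<in> ?M" by blast
      moreover from this have "u \<triangle> T = z \<triangle> S" by (simp only: T_def xor_shift)
      ultimately show ?thesis by blast
    qed
    then show ?thesis unfolding un image_Un j(2) k(2) by blast
  qed
  have le: "a \<le> b" "b \<le> m" using j(1) k(1) by (auto simp: a_def b_def)
  note ab = segment_invariant[OF le T inv]
  \<comment> \<open>The union has length one and contains both intervals, whose length is at least
    one, so they coincide.\<close>
  have L: "L = 1" and "j = k" using ab(1) assms(2) by (auto simp: a_def b_def min_def max_def split: if_splits)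
  then have "a = j" "b = j + L" by (auto simp: a_def b_def)
  moreover have "(f i \<triangle> S = f j \<and> f (i + L) \<triangle> S = f (j + L)) \<or> (f i \<triangle> S = f (j + L) \<and> f (i + L) \<triangle> S = f j)"
    using j(3) by (simp only: doubleton_eq_iff)
  ultimately have "T = (f i \<triangle> S) \<triangle> (f (i + L) \<triangle> S)" using ab(2) by (metis xor_ac(2))
  then have "T = f i \<triangle> f (i + L)" by (simp only: xor_xor)
  then show ?thesis using L by (simp add: T_def)
qed

lemma occ_unique:
  assumes "i + L \<le> m" "L \<ge> 2" "S \<in> occ (f ` {i..i+L})" "S1 \<in> occ (f ` {i..i+L})"
    and "x \<in> f ` {i..i+L}" "y \<in> f ` {i..i+L}"
    and "x \<triangle> S = y \<triangle> S1 \<or> (\<exists>c. (x \<triangle> S) \<triangle> (y \<triangle> S1) = {c})"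
  shows "S = S1"
proof (rule ccontr)
  assume "S \<noteq> S1"
  then have "L = 1" using occ_touch[OF assms(1) _ assms(3,4) _ assms(5,6,7)] assms(2) by simp
  then show False using assms(2) by simp
qed

end

section \<open>Permutations acting on all translates of a segment\<close>

text \<open>Inside \<open>R\<close>, a point \<open>s\<close> moved by both \<open>A\<close> and
  \<open>B\<close> yields the three-cycle \<open>s\<close>, \<open>A s\<close>, \<open>B s\<close>
  of the commutator: by \<open>iso\<close>, images of \<open>s\<close> under one permutation or its
  inverse are fixed by the other. All remaining points of \<open>R\<close> are fixed.\<close>

lemma commutator_cube:
  fixes A A' B B' :: "'a \<Rightarrow> 'a"
  assumes A: "\<And>x. A (A' x) = x" "\<And>x. A' (A x) = x"
    and B: "\<And>x. B (B' x) = x" "\<And>x. B' (B x) = x"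
    and R: "\<And>x. x \<in> R \<Longrightarrow> A' x \<in> R" "\<And>x. x \<in> R \<Longrightarrow> B' x \<in> R"
    and iso: "\<And>x. x \<in> R \<Longrightarrow> A x \<noteq> x \<Longrightarrow> B x \<noteq> x \<Longrightarrow>
      B (A x) = A x \<and> B (A' x) = A' x \<and> A (B x) = B x \<and> A (B' x) = B' x"
    and y: "y \<in> R"
  defines "K \<equiv> A \<circ> B \<circ> A' \<circ> B'"
  shows "(K \<circ> K \<circ> K) y = y"
proof -
  have fA: "A' x = x \<longleftrightarrow> A x = x" for x by (metis A)
  have fB: "B' x = x \<longleftrightarrow> B x = x" for x by (metis B)
  have K: "K x = A (B (A' (B' x)))" for x by (simp add: K_def)
  have s: "K s = A s \<and> K (A s) = B s \<and> K (B s) = s" if "s \<in> R" "A s \<noteq> s" "B s \<noteq> s" for s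
  proof -
    note i = iso[OF that]
    have "A' (B' s) = B' s" using i fA by blast
    then have 1: "K s = A s" by (simp add: K B)
    have "B' (A s) = A s" using i fB by blast
    then have 2: "K (A s) = B s" using i by (simp add: K A)
    have "B (A' s) = A' s" using i by blast
    then have "K (B s) = s" by (simp add: K A B)
    then show ?thesis using 1 2 by blast
  qed
  show ?thesis
  proof (cases "\<exists>s\<in>R. A s \<noteq> s \<and> B s \<noteq> s \<and> y \<in> {s, A s, B s}")
    case True
    then show ?thesis using s by fastforce
  next
    case False
    \<comment> \<open>If \<open>K\<close> moved \<open>y\<close>, one of \<open>y\<close>,
      \<open>B' y\<close> and \<open>A' y\<close> would be moved by both permutations, and
      \<open>y\<close> would lie in its three-cycle.\<close>
    have "K y = y"
    proof (cases "A (B' y) = B' y")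
      case True
      then have "A' (B' y) = B' y" using fA by blast
      then have "K y = A y" by (simp add: K B)
      moreover have "A y = y"
      proof (cases "B' y = y")
        case True
        then show ?thesis using \<open>A (B' y) = B' y\<close> by simp
      next
        case nf: False
        then have "B y \<noteq> y" using fB by blast
        then show ?thesis using False y by blast
      qed
      ultimately show ?thesis by simp
    next
      case nf: False
      have "B' y \<in> R" using R y by blast
      then have "B (B' y) = B' y" using False nf B(1) by fastforce
      then have e: "B' y = y" by (simp add: B)
      have "A' y \<in> R" using R y by blast
      moreover have "A (A' y) \<noteq> A' y" using nf e A by metis
      ultimately have "B (A' y) = A' y" using False A(1) by fastforce
      then show ?thesis by (simp add: K e A)
    qed
    then show ?thesis by simp
  qed
qed

section \<open>Spreading a permutation over the translates of a segment\<close>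

context snake
begin

abbreviation seg :: "nat \<Rightarrow> nat \<Rightarrow> 'e set set" where "seg i L \<equiv> f ` {i..i+L}"

definition spread :: "'e set set \<Rightarrow> ('e set \<Rightarrow> 'e set) \<Rightarrow> 'e set \<Rightarrow> 'e set" where
  "spread U \<pi> y = (if \<exists>S\<in>occ U. y \<triangle> S \<in> U
     then (let S = SOME S. S \<in> occ U \<and> y \<triangle> S \<in> U in \<pi> (y \<triangle> S) \<triangle> S) else y)"

text \<open>For segments with at least three vertices the choice in \<open>spread\<close> is unique.\<close>

lemma spread_eq:
  assumes "i + L \<le> m" "L \<ge> 2" "S \<in> occ (seg i L)" "x \<in> seg i L"
  shows "spread (seg i L) \<pi> (x \<triangle> S) = \<pi> x \<triangle> S"
proof -
  let ?U = "seg i L"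
  let ?P = "\<lambda>S'. S' \<in> occ ?U \<and> x \<triangle> S \<triangle> S' \<in> ?U"
  have P: "?P S" using assms by simp
  have "?P (SOME S'. ?P S')" using P by (rule someI)
  then have "(SOME S'. ?P S') = S"
    using occ_unique[OF assms(1,2), of "SOME S'. ?P S'" S "x \<triangle> S \<triangle> (SOME S'. ?P S')" x] assms(3,4)
    by simp
  then show ?thesis using P unfolding spread_def by (auto simp: Let_def)
qed

lemma spread_other:
  assumes "\<And>S. S \<in> occ U \<Longrightarrow> y \<triangle> S \<notin> U"
  shows "spread U \<pi> y = y"
  using assms by (auto simp: spread_def)

lemma spread_moved:
  assumes "spread U \<pi> y \<noteq> y"
  obtains S x where "S \<in> occ U" "x \<in> U" "y = x \<triangle> S"
proof -
  obtain S where "S \<in> occ U" "y \<triangle> S \<in> U" using assms spread_other by blast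
  then show thesis using that[of S "y \<triangle> S"] by simp
qed

text \<open>A permutation of the segment keeps each translate in itself, so the copies compose
  separately on each of them.\<close>

lemma spread_comp:
  assumes "i + L \<le> m" "L \<ge> 2" "\<sigma> permutes seg i L"
  shows "spread (seg i L) (\<pi> \<circ> \<sigma>) = spread (seg i L) \<pi> \<circ> spread (seg i L) \<sigma>"
proof
  fix y
  show "spread (seg i L) (\<pi> \<circ> \<sigma>) y = (spread (seg i L) \<pi> \<circ> spread (seg i L) \<sigma>) y"
  proof (cases "\<exists>S\<in>occ (seg i L). y \<triangle> S \<in> seg i L")
    case True
    then obtain S where S: "S \<in> occ (seg i L)" "y \<triangle> S \<in> seg i L" by blast
    then have "\<sigma> (y \<triangle> S) \<in> seg i L" using assms(3) by (simp only: permutes_in_image)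
    then show ?thesis
      using spread_eq[OF assms(1,2) S] spread_eq[OF assms(1,2) S(1), of "\<sigma> (y \<triangle> S)"]
      by simp
  next
    case False
    then have "spread (seg i L) \<tau> y = y" for \<tau> by (intro spread_other) blast
    then show ?thesis by simp
  qed
qed

lemma spread_id: "spread U id = id"
  by (auto simp: spread_def Let_def fun_eq_iff)

section \<open>The group generated by the toggles of the path\<close>

inductive_set toggle_group :: "('e set \<Rightarrow> 'e set) set" where
  id: "id \<in> toggle_group"
| toggle: "g \<in> toggle_group \<Longrightarrow> toggle X c \<circ> g \<in> toggle_group"

lemma toggle_in_toggle_group: "toggle X c \<in> toggle_group"
  using toggle_group.toggle[OF toggle_group.id, of c] by simp

lemma toggle_group_comp: "g \<in> toggle_group \<Longrightarrow> h \<in> toggle_group \<Longrightarrow> g \<circ> h \<in> toggle_group"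
  by (induction rule: toggle_group.induct) (auto simp: comp_assoc intro: toggle_group.intros)

lemma toggle_eq: "toggle X c x = (if x \<in> X \<and> x \<triangle> {c} \<in> X then x \<triangle> {c} else x)"
proof -
  have "x \<triangle> {c} = (if c \<in> x then x - {c} else insert c x)" by (auto simp: xor_def)
  then show ?thesis by (auto simp: toggle_def)
qed

lemma toggle_toggle: "toggle X c \<circ> toggle X c = id"
  by (auto simp: fun_eq_iff toggle_eq)

text \<open>The rules only generate a monoid; it is a group because toggles are involutions.\<close>

lemma toggle_group_inverse: "g \<in> toggle_group \<Longrightarrow> \<exists>h\<in>toggle_group. h \<circ> g = id \<and> g \<circ> h = id"
proof (induction rule: toggle_group.induct)
  case id
  show ?case by (rule bexI[of _ id]) (auto intro: toggle_group.id)
next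
  case (toggle g c)
  then obtain h where h: "h \<in> toggle_group" "h \<circ> g = id" "g \<circ> h = id" by blast
  have "(h \<circ> toggle X c) \<circ> (toggle X c \<circ> g) = h \<circ> (toggle X c \<circ> toggle X c) \<circ> g"
    "(toggle X c \<circ> g) \<circ> (h \<circ> toggle X c) = toggle X c \<circ> (g \<circ> h) \<circ> toggle X c"
    by (simp_all only: comp_assoc)
  then have "(h \<circ> toggle X c) \<circ> (toggle X c \<circ> g) = id" "(toggle X c \<circ> g) \<circ> (h \<circ> toggle X c) = id"
    by (simp_all only: toggle_toggle h comp_id)
  then show ?case using toggle_group_comp[OF h(1) toggle_in_toggle_group[of c]] by blast
qed

text \<open>The permutations of \<open>U\<close> that toggles can perform on all translates of
  \<open>U\<close> at once while fixing everything else.\<close>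

definition localized :: "'e set set \<Rightarrow> ('e set \<Rightarrow> 'e set) set" where
  "localized U = {\<pi>. \<pi> permutes U \<and> spread U \<pi> \<in> toggle_group}"

lemma localized_comp:
  assumes "i + L \<le> m" "L \<ge> 2" "\<pi> \<in> localized (seg i L)" "\<sigma> \<in> localized (seg i L)"
  shows "\<pi> \<circ> \<sigma> \<in> localized (seg i L)"
  using assms by (auto simp: localized_def spread_comp permutes_compose toggle_group_comp)

lemma spread_inv:
  assumes "i + L \<le> m" "L \<ge> 2" "\<pi> permutes seg i L"
  shows "spread (seg i L) \<pi> \<circ> spread (seg i L) (inv' \<pi>) = id"
    "spread (seg i L) (inv' \<pi>) \<circ> spread (seg i L) \<pi> = id"
  using assms by (simp_all add: permutes_inv permutes_inv_o spread_id flip: spread_comp)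

lemma localized_inv:
  assumes "i + L \<le> m" "L \<ge> 2" "\<pi> \<in> localized (seg i L)"
  shows "inv' \<pi> \<in> localized (seg i L)"
proof -
  have p: "\<pi> permutes seg i L" using assms by (simp add: localized_def)
  obtain h where h: "h \<in> toggle_group" "h \<circ> spread (seg i L) \<pi> = id"
    using toggle_group_inverse assms(3) by (auto simp: localized_def)
  have "h = h \<circ> (spread (seg i L) \<pi> \<circ> spread (seg i L) (inv' \<pi>))"
    using spread_inv[OF assms(1,2) p] by simp
  also have "\<dots> = spread (seg i L) (inv' \<pi>)" using h(2) by (simp add: comp_assoc[symmetric])
  finally show ?thesis using h p by (simp add: localized_def permutes_inv)
qed

section \<open>Overlaps between translates of two consecutive segments\<close>

lemma occ_mono: "A \<subseteq> B \<Longrightarrow> occ B \<subseteq> occ A"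
  by (auto simp: occ_def)

lemma occ_in_X: "S \<in> occ U \<Longrightarrow> x \<in> U \<Longrightarrow> x \<triangle> S \<in> X"
  by (auto simp: occ_def)

lemma adjacent: "i < m \<Longrightarrow> \<exists>c. (f i \<triangle> S) \<triangle> (f (Suc i) \<triangle> S) = {c}"
  "i < m \<Longrightarrow> \<exists>c. (f (Suc i) \<triangle> S) \<triangle> (f i \<triangle> S) = {c}"
  unfolding xor_xor using step[of i] by (simp, metis xor_ac(2))

text \<open>By \<open>chordless\<close>, a neighbor of \<open>f i\<close> has one of the two indices
  next to \<open>i\<close>.\<close>

lemma no_three_neighbours:
  assumes "p \<in> X" "a \<in> X" "b \<in> X" "c \<in> X" "p \<triangle> a = {x}" "p \<triangle> b = {y}" "p \<triangle> c = {z}"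
  shows "a = b \<or> b = c \<or> a = c"
proof -
  obtain i j k l where f: "i \<le> m" "j \<le> m" "k \<le> m" "l \<le> m" "p = f i" "a = f j" "b = f k" "c = f l"
    using assms(1-4) by (auto simp: X_def)
  show ?thesis using assms(5-7) chordless[of i j x] chordless[of i k y] chordless[of i l z] f by auto
qed

text \<open>Any other common vertex makes two translates of the common part \<open>?M\<close> meet
  or be adjacent. By \<open>occ_touch\<close>, \<open>?M\<close> is then one edge and the translates
  differ by exchanging its ends; a vertex of that edge would have three neighbors.\<close>

lemma overlap:
  assumes m: "i + Suc L \<le> m" and L: "L \<ge> 2"
    and S: "S \<in> occ (seg i L)" "S1 \<in> occ (seg (Suc i) L)" "S \<noteq> S1"
    and xy: "x \<in> seg i L" "y \<in> seg (Suc i) L" "x \<triangle> S = y \<triangle> S1"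
  shows "x = f i \<and> y = f (Suc (i + L))"
proof (rule ccontr)
  assume neg: "\<not> ?thesis"
  let ?M = "seg (Suc i) (L - 1)"
  have M: "?M \<subseteq> seg i L" "?M \<subseteq> seg (Suc i) L" using L by auto
  have x: "x = f i \<or> x \<in> ?M"
  proof -
    obtain t where "x = f t" "t \<in> {i..i+L}" using xy(1) by blast
    then show ?thesis using L by (cases "t = i") auto
  qed
  have y: "y = f (Suc (i + L)) \<or> y \<in> ?M"
  proof -
    obtain t where "y = f t" "t \<in> {Suc i..Suc i+L}" using xy(2) by blast
    then show ?thesis using L by (cases "t = Suc (i + L)") auto
  qed
  have first: "f (Suc i) \<in> ?M" and last: "f (i + L) \<in> ?M" using L by auto
  \<comment> \<open>If one of \<open>x\<close>, \<open>y\<close> is the outer end of its segment,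
    its neighbor in \<open>?M\<close> replaces it, and adjacency replaces equality.\<close>
  have "\<exists>u\<in>?M. \<exists>v\<in>?M. u \<triangle> S = v \<triangle> S1 \<or> (\<exists>c. (u \<triangle> S) \<triangle> (v \<triangle> S1) = {c})"
  proof (cases "x \<in> ?M")
    case True
    show ?thesis
    proof (cases "y \<in> ?M")
      case False
      then have "y = f (Suc (i + L))" using y by blast
      then have "\<exists>c. (x \<triangle> S) \<triangle> (f (i + L) \<triangle> S1) = {c}" unfolding xy(3) using adjacent[of "i+L" S1] m by auto
      then show ?thesis using True last by blast
    qed (use True xy(3) in blast)
  next
    case False
    then have x': "x = f i" and "y \<in> ?M" using x y neg by blast+
    moreover have "\<exists>c. (f (Suc i) \<triangle> S) \<triangle> (x \<triangle> S) = {c}"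
      unfolding x' by (rule adjacent(2)) (use m in simp)
    ultimately show ?thesis using first unfolding xy(3) by blast
  qed
  then obtain u v where "u \<in> ?M" "v \<in> ?M" "u \<triangle> S = v \<triangle> S1 \<or> (\<exists>c. (u \<triangle> S) \<triangle> (v \<triangle> S1) = {c})"
    by blast
  moreover have "S \<in> occ ?M" "S1 \<in> occ ?M" using occ_mono M S by blast+
  ultimately have "L - 1 = 1" and T: "S \<triangle> S1 = f (Suc i) \<triangle> f (Suc (Suc i))"
    using occ_touch[of "Suc i" "L - 1" S S1 u v] m L S(3) by auto
  then have L2: "L = 2" by simp
  \<comment> \<open>Both translates put the edge \<open>?M\<close> on the same two vertices in
    opposite order, and both extend it by a further vertex next to \<open>?p\<close>.\<close>
  let ?p = "f (Suc i) \<triangle> S"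
  have p: "?p = f (Suc (Suc i)) \<triangle> S1" and r: "f (Suc (Suc i)) \<triangle> S = f (Suc i) \<triangle> S1"
    using T by (metis xor_ac(1,2) xor_cancel(5))+
  have mem: "?p \<in> X" "f i \<triangle> S \<in> X" "f (Suc (Suc i)) \<triangle> S \<in> X" "f (Suc (Suc (Suc i))) \<triangle> S1 \<in> X"
    using S(1,2) L2 by (auto intro!: occ_in_X)
  obtain a where a: "?p \<triangle> (f i \<triangle> S) = {a}" using adjacent(2)[of i S] m by auto
  obtain b where b: "?p \<triangle> (f (Suc (Suc i)) \<triangle> S) = {b}" using adjacent(1)[of "Suc i" S] m L2 by auto
  obtain c where c: "?p \<triangle> (f (Suc (Suc (Suc i))) \<triangle> S1) = {c}"
    unfolding p using adjacent(1)[of "Suc (Suc i)" S1] m L2 by auto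
  from no_three_neighbours[OF mem a b c] show False
  proof (elim disjE)
    assume "f i \<triangle> S = f (Suc (Suc i)) \<triangle> S"
    then show False using m L2 by simp
  next
    assume "f (Suc (Suc i)) \<triangle> S = f (Suc (Suc (Suc i))) \<triangle> S1"
    then show False using m L2 by (simp add: r)
  next
    assume "f i \<triangle> S = f (Suc (Suc (Suc i))) \<triangle> S1"
    then have "f i \<triangle> f (Suc (Suc (Suc i))) = S \<triangle> S1" by (metis xor_ac(1,2) xor_cancel(5))
    then obtain d where "f i \<triangle> f (Suc (Suc (Suc i))) = {d}" using T step[of "Suc i"] m L2 by auto
    then show False using chordless[of i "Suc (Suc (Suc i))" d] m L2 by auto
  qed
qed

text \<open>The shared vertex is the outer end of each segment. If one of the sets also translated
  the other segment into the path, that segment would have two distinct adjacent translates, against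
  \<open>occ_unique\<close>.\<close>

lemma overlap_isolated:
  assumes m: "i + Suc L \<le> m" and L: "L \<ge> 2"
    and S: "S \<in> occ (seg i L)" "S1 \<in> occ (seg (Suc i) L)" "S \<noteq> S1"
    and e: "f i \<triangle> S = f (Suc (i + L)) \<triangle> S1"
  shows "S \<notin> occ (seg (Suc i) L)" "S1 \<notin> occ (seg i L)"
proof -
  show "S \<notin> occ (seg (Suc i) L)"
  proof
    assume S2: "S \<in> occ (seg (Suc i) L)"
    have "\<exists>c. (f (Suc i) \<triangle> S) \<triangle> (f (Suc (i + L)) \<triangle> S1) = {c}"
      using adjacent(2)[of i S] m unfolding e by auto
    then show False
      using occ_unique[OF _ L S2 S(2), of "f (Suc i)" "f (Suc (i + L))"] m S(3) by auto
  qed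
  show "S1 \<notin> occ (seg i L)"
  proof
    assume S2: "S1 \<in> occ (seg i L)"
    have "\<exists>c. (f i \<triangle> S) \<triangle> (f (i + L) \<triangle> S1) = {c}"
      using adjacent(2)[of "i+L" S1] m unfolding e by auto
    then show False
      using occ_unique[OF _ L S(1) S2, of "f i" "f (i + L)"] m S(3) by auto
  qed
qed


text \<open>On translates of the union, the commutator \<open>C\<close> of the two spreads acts as
  \<open>K\<close>. Off these translates, a point moved by both spreads is isolated in the sense of
  \<open>commutator_cube\<close>, so the cube of \<open>C\<close> is trivial there.\<close>

lemma localize:
  assumes m: "i + Suc L \<le> m" and L: "L \<ge> 2"
    and \<pi>: "\<pi> \<in> localized (seg i L)" and \<rho>: "\<rho> \<in> localized (seg (Suc i) L)"
  defines "K \<equiv> \<pi> \<circ> \<rho> \<circ> inv' \<pi> \<circ> inv' \<rho>"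
  shows "K \<circ> K \<circ> K \<in> localized (seg i (Suc L))"
proof -
  let ?U = "seg i L" and ?V = "seg (Suc i) L" and ?W = "seg i (Suc L)"
  have pU: "\<pi> permutes ?U" "inv' \<pi> permutes ?U" and pV: "\<rho> permutes ?V" "inv' \<rho> permutes ?V"
    using \<pi> \<rho> by (auto simp: localized_def permutes_inv)
  have mU: "i + L \<le> m" and mV: "Suc i + L \<le> m" using m by auto
  have UW: "?U \<subseteq> ?W" and VW: "?V \<subseteq> ?W" by auto
  have "{i..i + Suc L} = {i..i+L} \<union> {Suc i..Suc i+L}" by auto
  then have WUV: "?W = ?U \<union> ?V" by (simp add: image_Un)
  then have occ_W: "occ ?W = occ ?U \<inter> occ ?V" by (auto simp: occ_def)
  have WU: "x = f (Suc (i + L))" if w: "x \<in> ?W" "x \<notin> ?U" for x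
  proof -
    obtain t where t: "x = f t" "t \<in> {i..i + Suc L}" using w(1) by blast
    then have "t = Suc (i + L)" using w(2) by (cases "t \<le> i + L") auto
    then show ?thesis using t by simp
  qed
  have WV: "x = f i" if w: "x \<in> ?W" "x \<notin> ?V" for x
  proof -
    obtain t where t: "x = f t" "t \<in> {i..i + Suc L}" using w(1) by blast
    then have "t = i" using w(2) by (cases "Suc i \<le> t") auto
    then show ?thesis using t by simp
  qed
  \<comment> \<open>The delicate point is the vertex of \<open>?W\<close> outside \<open>?U\<close>:
    if its image lay in another translate of \<open>?U\<close>, \<open>overlap_isolated\<close>
    would be violated.\<close>
  have actU: "spread ?U \<sigma> (x \<triangle> S) = \<sigma> x \<triangle> S"
    if "\<sigma> permutes ?U" "S \<in> occ ?W" "x \<in> ?W" for \<sigma> S x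
  proof (cases "x \<in> ?U")
    case True
    then show ?thesis using that occ_W spread_eq[OF mU L] by blast
  next
    case False
    then have x: "x = f (Suc (i + L))" using that WU by blast
    have "spread ?U \<sigma> (x \<triangle> S) = x \<triangle> S"
    proof (rule ccontr)
      assume "\<not> ?thesis"
      then obtain T u where T: "T \<in> occ ?U" "u \<in> ?U" "x \<triangle> S = u \<triangle> T" by (rule spread_moved)
      then have "T \<noteq> S" using False by auto
      moreover have S: "S \<in> occ ?V" "S \<in> occ ?U" "x \<in> ?V" using that occ_W False WUV by auto
      ultimately have "u = f i" using overlap[OF m L T(1) S(1) _ T(2) S(3)] T(3) by simp
      then show False using overlap_isolated[OF m L T(1) S(1) \<open>T \<noteq> S\<close>] T(3) x S(2) by simp
    qed
    then show ?thesis using that(1) False by (simp add: permutes_not_in)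
  qed
  have actV: "spread ?V \<sigma> (x \<triangle> S) = \<sigma> x \<triangle> S"
    if "\<sigma> permutes ?V" "S \<in> occ ?W" "x \<in> ?W" for \<sigma> S x
  proof (cases "x \<in> ?V")
    case True
    then show ?thesis using that occ_W spread_eq[OF mV L] by blast
  next
    case False
    then have x: "x = f i" using that WV by blast
    have "spread ?V \<sigma> (x \<triangle> S) = x \<triangle> S"
    proof (rule ccontr)
      assume "\<not> ?thesis"
      then obtain T u where T: "T \<in> occ ?V" "u \<in> ?V" "x \<triangle> S = u \<triangle> T" by (rule spread_moved)
      then have "S \<noteq> T" using False by auto
      moreover have S: "S \<in> occ ?V" "S \<in> occ ?U" "x \<in> ?U" using that occ_W False WUV by auto
      ultimately have "u = f (Suc (i + L))" using overlap[OF m L S(2) T(1) _ S(3) T(2,3)] by simp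
      then show False using overlap_isolated[OF m L S(2) T(1) \<open>S \<noteq> T\<close>] T(3) x S(1) by simp
    qed
    then show ?thesis using that(1) False by (simp add: permutes_not_in)
  qed
  have pW: "\<pi> permutes ?W" "inv' \<pi> permutes ?W" "\<rho> permutes ?W" "inv' \<rho> permutes ?W"
    using pU pV UW VW by (blast intro: permutes_subset)+
  have KW: "K permutes ?W" unfolding K_def using pW by (intro permutes_compose)
  define A A' B B' where "A = spread ?U \<pi>" and "A' = spread ?U (inv' \<pi>)"
    and "B = spread ?V \<rho>" and "B' = spread ?V (inv' \<rho>)"
  define C where "C = A \<circ> B \<circ> A' \<circ> B'"
  \<comment> \<open>The sets lying in no translate of \<open>?W\<close>; here the cube of
    \<open>C\<close> has to be the identity.\<close>
  define R where "R = {y. \<forall>S\<in>occ ?W. y \<triangle> S \<notin> ?W}"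
  have AA: "A (A' x) = x" "A' (A x) = x" for x
    using spread_inv[OF mU L pU(1)] by (simp_all add: A_def A'_def fun_eq_iff)
  have BB: "B (B' x) = x" "B' (B x) = x" for x
    using spread_inv[OF mV L pV(1)] by (simp_all add: B_def B'_def fun_eq_iff)
  have RA: "A' x \<in> R" if "x \<in> R" for x
  proof (rule ccontr)
    assume "A' x \<notin> R"
    then obtain S where S: "S \<in> occ ?W" "A' x \<triangle> S \<in> ?W" by (auto simp: R_def)
    have "x = A (A' x \<triangle> S \<triangle> S)" by (simp add: AA)
    also have "\<dots> = \<pi> (A' x \<triangle> S) \<triangle> S" unfolding A_def using actU[OF pU(1) S] .
    finally have "x \<triangle> S = \<pi> (A' x \<triangle> S)" by (simp add: xor_eq_iff)
    then have "x \<triangle> S \<in> ?W" using S(2) pW(1) by (simp only: permutes_in_image)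
    then show False using S(1) that by (auto simp: R_def)
  qed
  have RB: "B' x \<in> R" if "x \<in> R" for x
  proof (rule ccontr)
    assume "B' x \<notin> R"
    then obtain S where S: "S \<in> occ ?W" "B' x \<triangle> S \<in> ?W" by (auto simp: R_def)
    have "x = B (B' x \<triangle> S \<triangle> S)" by (simp add: BB)
    also have "\<dots> = \<rho> (B' x \<triangle> S) \<triangle> S" unfolding B_def using actV[OF pV(1) S] .
    finally have "x \<triangle> S = \<rho> (B' x \<triangle> S)" by (simp add: xor_eq_iff)
    then have "x \<triangle> S \<in> ?W" using S(2) pW(3) by (simp only: permutes_in_image)
    then show False using S(1) that by (auto simp: R_def)
  qed
  \<comment> \<open>Such an \<open>x\<close> lies in a translate of \<open>?U\<close> and in one of
    \<open>?V\<close>, by different sets. By \<open>overlap\<close> each of them meets the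
    translates of the other segment in \<open>x\<close> alone, so moving \<open>x\<close> within one
    leaves the support of the other spread.\<close>
  have iso: "B (A x) = A x \<and> B (A' x) = A' x \<and> A (B x) = B x \<and> A (B' x) = B' x"
    if x: "x \<in> R" "A x \<noteq> x" "B x \<noteq> x" for x
  proof -
    obtain S u where S: "S \<in> occ ?U" "u \<in> ?U" "x = u \<triangle> S" by (rule spread_moved[OF x(2)[unfolded A_def]])
    obtain T v where T: "T \<in> occ ?V" "v \<in> ?V" "x = v \<triangle> T" by (rule spread_moved[OF x(3)[unfolded B_def]])
    have ST: "S \<noteq> T"
    proof
      assume "S = T"
      then have "S \<in> occ ?W" "x \<triangle> S \<in> ?W" using S T occ_W UW by auto
      then show False using x(1) by (auto simp: R_def)
    qed
    have uv: "u = f i" "v = f (Suc (i + L))" using overlap[OF m L S(1) T(1) ST S(2) T(2)] S(3) T(3) by auto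
    have n: "S \<notin> occ ?V" "T \<notin> occ ?U"
      using overlap_isolated[OF m L S(1) T(1) ST] S(3) T(3) uv by auto
    have 1: "B (spread ?U \<sigma> x) = spread ?U \<sigma> x" if \<sigma>: "\<sigma> permutes ?U" "spread ?U \<sigma> x \<noteq> x" for \<sigma>
    proof (rule ccontr)
      assume "\<not> ?thesis"
      then obtain T' v' where T': "T' \<in> occ ?V" "v' \<in> ?V" "spread ?U \<sigma> x = v' \<triangle> T'"
        unfolding B_def by (rule spread_moved)
      have e: "spread ?U \<sigma> x = \<sigma> u \<triangle> S" using spread_eq[OF mU L S(1,2)] S(3) by simp
      have "\<sigma> u \<in> ?U" using S(2) \<sigma>(1) by (simp only: permutes_in_image)
      moreover have "S \<noteq> T'" using n(1) T'(1) by metis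
      moreover have "\<sigma> u \<triangle> S = v' \<triangle> T'" using T'(3) e by simp
      ultimately have "\<sigma> u = u" using overlap[OF m L S(1) T'(1) _ _ T'(2), of "\<sigma> u"] uv(1) by metis
      then show False using \<sigma>(2) e S(3) by simp
    qed
    have 2: "A (spread ?V \<sigma> x) = spread ?V \<sigma> x" if \<sigma>: "\<sigma> permutes ?V" "spread ?V \<sigma> x \<noteq> x" for \<sigma>
    proof (rule ccontr)
      assume "\<not> ?thesis"
      then obtain S' u' where S': "S' \<in> occ ?U" "u' \<in> ?U" "spread ?V \<sigma> x = u' \<triangle> S'"
        unfolding A_def by (rule spread_moved)
      have e: "spread ?V \<sigma> x = \<sigma> v \<triangle> T" using spread_eq[OF mV L T(1,2)] T(3) by simp
      have "\<sigma> v \<in> ?V" using T(2) \<sigma>(1) by (simp only: permutes_in_image)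
      moreover have "S' \<noteq> T" using n(2) S'(1) by metis
      moreover have "u' \<triangle> S' = \<sigma> v \<triangle> T" using S'(3) e by simp
      ultimately have "\<sigma> v = v" using overlap[OF m L S'(1) T(1) _ S'(2), of "\<sigma> v"] uv(2) by metis
      then show False using \<sigma>(2) e T(3) by simp
    qed
    have "A' x \<noteq> x" "B' x \<noteq> x" using x AA BB by metis+
    then show ?thesis using 1[OF pU(1)] 1[OF pU(2)] 2[OF pV(1)] 2[OF pV(2)] x
      unfolding A_def A'_def B_def B'_def by blast
  qed
  have "spread ?W (K \<circ> K \<circ> K) = C \<circ> C \<circ> C"
  proof
    fix y
    show "spread ?W (K \<circ> K \<circ> K) y = (C \<circ> C \<circ> C) y"
    proof (cases "y \<in> R")
      case True
      then have "spread ?W (K \<circ> K \<circ> K) y = y" by (intro spread_other) (auto simp: R_def)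
      also have "\<dots> = (C \<circ> C \<circ> C) y"
        unfolding C_def using commutator_cube[OF AA BB RA RB iso True] by simp
      finally show ?thesis .
    next
      case False
      then obtain S where "S \<in> occ ?W" "y \<triangle> S \<in> ?W" by (auto simp: R_def)
      moreover define x where "x = y \<triangle> S"
      ultimately have S: "S \<in> occ ?W" "x \<in> ?W" "y = x \<triangle> S" by simp_all
      have pim: "\<sigma> x \<in> ?W" if "\<sigma> permutes ?W" "x \<in> ?W" for \<sigma> x
        using that by (simp only: permutes_in_image)
      have C: "C (x \<triangle> S) = K x \<triangle> S" if "x \<in> ?W" for x
      proof -
        have "B' (x \<triangle> S) = inv' \<rho> x \<triangle> S"
          unfolding B'_def by (rule actV[OF pV(2) S(1) that])
        moreover have "A' (inv' \<rho> x \<triangle> S) = inv' \<pi> (inv' \<rho> x) \<triangle> S"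
          unfolding A'_def by (rule actU[OF pU(2) S(1) pim[OF pW(4) that]])
        moreover have "B (inv' \<pi> (inv' \<rho> x) \<triangle> S) = \<rho> (inv' \<pi> (inv' \<rho> x)) \<triangle> S"
          unfolding B_def by (rule actV[OF pV(1) S(1) pim[OF pW(2) pim[OF pW(4) that]]])
        moreover have "A (\<rho> (inv' \<pi> (inv' \<rho> x)) \<triangle> S) = \<pi> (\<rho> (inv' \<pi> (inv' \<rho> x))) \<triangle> S"
          unfolding A_def by (rule actU[OF pU(1) S(1) pim[OF pW(3) pim[OF pW(2) pim[OF pW(4) that]]]])
        ultimately show ?thesis by (simp add: C_def K_def)
      qed
      have "(C \<circ> C \<circ> C) y = K (K (K x)) \<triangle> S" using C pim[OF KW] S(2,3) by simp
      moreover have "spread ?W (K \<circ> K \<circ> K) y = K (K (K x)) \<triangle> S"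
        using spread_eq[OF m _ S(1,2)] L S(3) by simp
      ultimately show ?thesis by simp
    qed
  qed
  moreover have "C \<in> toggle_group"
    unfolding C_def A_def A'_def B_def B'_def using \<pi> \<rho> localized_inv[OF mU L \<pi>] localized_inv[OF mV L \<rho>]
    by (intro toggle_group_comp) (auto simp: localized_def)
  then have "C \<circ> C \<circ> C \<in> toggle_group" by (intro toggle_group_comp)
  moreover have "K \<circ> K \<circ> K permutes ?W" using KW by (intro permutes_compose)
  ultimately show ?thesis by (simp add: localized_def)
qed

section \<open>Three-cycles on three consecutive vertices\<close>

lemma no_square:
  assumes "x \<in> X" "x \<triangle> {a} \<in> X" "x \<triangle> {a} \<triangle> {b} \<in> X" "x \<triangle> {b} \<in> X"
  shows "a = b"
proof (rule ccontr)
  assume ab: "a \<noteq> b"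
  obtain p q r k where f: "p \<le> m" "q \<le> m" "r \<le> m" "k \<le> m" "x = f p" "x \<triangle> {a} = f q"
    "x \<triangle> {a} \<triangle> {b} = f r" "x \<triangle> {b} = f k"
    using assms by (auto simp: X_def)
  have d: "f p \<triangle> f q = {a}" "f q \<triangle> f r = {b}" "f r \<triangle> f k = {a}" "f k \<triangle> f p = {b}"
    unfolding f(5-8)[symmetric] using ab by (auto simp: xor_def)
  have n: "f p \<noteq> f r" "f q \<noteq> f k"
    unfolding f(5-8)[symmetric] using ab by (auto simp: xor_def)
  \<comment> \<open>Neighboring corners have consecutive indices. As \<open>p\<close> and
    \<open>r\<close> are distinct, both \<open>q\<close> and \<open>k\<close> would be the index
    midway between them.\<close>
  have "p \<noteq> r" "q \<noteq> k" using n by auto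
  then show False
    using chordless[OF _ _ d(1)] chordless[OF _ _ d(2)] chordless[OF _ _ d(3)] chordless[OF _ _ d(4)] f(1-4)
    by linarith
qed

text \<open>The three-cycle is the commutator of the two toggles.\<close>

lemma three_cycle:
  assumes m: "i + 2 \<le> m"
  shows "transpose (f (Suc i)) (f (i + 2)) \<circ> transpose (f i) (f (Suc i)) \<in> localized (seg i 2)"
proof -
  let ?U = "seg i 2"
  let ?\<pi> = "transpose (f (Suc i)) (f (i + 2)) \<circ> transpose (f i) (f (Suc i))"
  obtain a where a: "f i \<triangle> f (Suc i) = {a}" using step[of i] m by auto
  obtain b where b: "f (Suc i) \<triangle> f (i + 2) = {b}" using step[of "Suc i"] m by auto
  have ne: "f i \<noteq> f (Suc i)" "f (Suc i) \<noteq> f (i + 2)" "f i \<noteq> f (i + 2)" using m by auto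
  have f: "f i = f (Suc i) \<triangle> {a}" "f (i + 2) = f (Suc i) \<triangle> {b}"
    using a b by (metis xor_ac(2) xor_cancel(4), metis xor_cancel(4))
  have ab: "a \<noteq> b" using ne f by auto
  have "{i..i+2} = {i, Suc i, i + 2}" by auto
  then have U: "?U = {f i, f (Suc i), f (i + 2)}" by simp
  let ?A = "toggle X a" and ?B = "toggle X b"
  have "spread ?U ?\<pi> = ?A \<circ> ?B \<circ> ?A \<circ> ?B"
  proof
    fix y
    show "spread ?U ?\<pi> y = (?A \<circ> ?B \<circ> ?A \<circ> ?B) y"
    proof (cases "\<exists>S\<in>occ ?U. y \<triangle> S \<in> ?U")
      case True
      then obtain S where S: "S \<in> occ ?U" "y \<triangle> S \<in> ?U" by blast
      define x where "x = f (Suc i) \<triangle> S"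
      have x: "f (Suc i) \<triangle> S = x" "f i \<triangle> S = x \<triangle> {a}" "f (i + 2) \<triangle> S = x \<triangle> {b}"
        unfolding x_def f by (simp_all add: xor_ac)
      have X: "x \<in> X" "x \<triangle> {a} \<in> X" "x \<triangle> {b} \<in> X" using occ_in_X[OF S(1)] U x by force+
      \<comment> \<open>The fourth corner of the square is missing, so each of the two toggles moves
        just one edge of the corner at \<open>x\<close>.\<close>
      have n: "x \<triangle> {a} \<triangle> {b} \<notin> X" using no_square X ab by blast
      then have n': "x \<triangle> {b} \<triangle> {a} \<notin> X" by (simp add: xor_ac)
      have T: "?A x = x \<triangle> {a}" "?A (x \<triangle> {a}) = x" "?A (x \<triangle> {b}) = x \<triangle> {b}"
        "?B x = x \<triangle> {b}" "?B (x \<triangle> {b}) = x" "?B (x \<triangle> {a}) = x \<triangle> {a}"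
        using X n n' by (simp_all add: toggle_eq)
      have y: "y = y \<triangle> S \<triangle> S" by simp
      have "spread ?U ?\<pi> y = ?\<pi> (y \<triangle> S) \<triangle> S" using spread_eq[OF m _ S] by simp
      moreover consider "y \<triangle> S = f i" | "y \<triangle> S = f (Suc i)" | "y \<triangle> S = f (i + 2)" using S(2) U by blast
      then have "?\<pi> (y \<triangle> S) \<triangle> S = (?A \<circ> ?B \<circ> ?A \<circ> ?B) y"
      proof cases
        case 1
        then have "y = x \<triangle> {a}" using y x by simp
        then show ?thesis using 1 T x ne by (simp add: transpose_def)
      next
        case 2
        then have "y = x" using y x by simp
        then show ?thesis using 2 T x ne by (simp add: transpose_def)
      next
        case 3
        then have "y = x \<triangle> {b}" using y x by simp
        then show ?thesis using 3 T x ne by (simp add: transpose_def)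
      qed
      ultimately show ?thesis by simp
    next
      case False
      \<comment> \<open>A vertex with neighbors in both directions \<open>a\<close> and
        \<open>b\<close> is the middle of a translate of \<open>?U\<close>. Outside all translates
        no such corner contains \<open>y\<close>, so the two toggles commute at
        \<open>y\<close>.\<close>
      have corner: "y \<notin> {z, z \<triangle> {a}, z \<triangle> {b}}" if z: "z \<in> X" "z \<triangle> {a} \<in> X" "z \<triangle> {b} \<in> X" for z
      proof
        assume y: "y \<in> {z, z \<triangle> {a}, z \<triangle> {b}}"
        let ?S = "z \<triangle> f (Suc i)"
        have s: "f (Suc i) \<triangle> ?S = z" "f i \<triangle> ?S = z \<triangle> {a}" "f (i + 2) \<triangle> ?S = z \<triangle> {b}"
          unfolding f by (auto simp: xor_def)
        then have "?S \<in> occ ?U" using z unfolding occ_def U by simp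
        moreover have "y \<triangle> ?S \<in> ?U" 
        proof -
          have "y = f (Suc i) \<triangle> ?S \<or> y = f i \<triangle> ?S \<or> y = f (i + 2) \<triangle> ?S"
            using y unfolding s by blast
          then show ?thesis unfolding U by (elim disjE) simp_all
        qed
        ultimately show False using False by blast
      qed
      have "spread ?U ?\<pi> y = y" using False by (intro spread_other) blast
      moreover have "(?A \<circ> ?B \<circ> ?A \<circ> ?B) y = y"
        using corner[of y] corner[of "y \<triangle> {a}"] corner[of "y \<triangle> {b}"]
        by (auto simp: toggle_eq)
      ultimately show ?thesis by simp
    qed
  qed
  moreover have "?A \<circ> ?B \<circ> ?A \<circ> ?B \<in> toggle_group" by (intro toggle_group_comp toggle_in_toggle_group)
  moreover have "?\<pi> permutes ?U"
    unfolding U by (intro permutes_compose permutes_swap_id) auto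
  ultimately show ?thesis by (simp add: localized_def)
qed

end

section \<open>Double transpositions and five-cycles\<close>

text \<open>\<open>\<pi>\<close> and \<open>\<rho>\<close> are three-cycles sharing the points
  \<open>b\<close> and \<open>c\<close>, with inverses \<open>\<pi>'\<close> and
  \<open>\<rho>'\<close>. Inverting one of them before taking the commutator produces the other
  double transpositions of the four points.\<close>

lemma commutator_three_cycles:
  assumes "distinct [a, b, c, d]"
  defines "\<pi> \<equiv> transpose b c \<circ> transpose a b" and "\<pi>' \<equiv> transpose a b \<circ> transpose b c"
    and "\<rho> \<equiv> transpose c d \<circ> transpose b c" and "\<rho>' \<equiv> transpose b c \<circ> transpose c d"
  shows "\<pi> \<circ> \<rho> \<circ> \<pi>' \<circ> \<rho>' = transpose a d \<circ> transpose b c"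
    "\<pi> \<circ> \<rho>' \<circ> \<pi>' \<circ> \<rho> = transpose a b \<circ> transpose c d"
    "\<pi>' \<circ> \<rho> \<circ> \<pi> \<circ> \<rho>' = transpose a c \<circ> transpose b d"
proof -
  have ne: "a \<noteq> b" "a \<noteq> c" "a \<noteq> d" "b \<noteq> c" "b \<noteq> d" "c \<noteq> d"
    using assms(1) by auto
  note ne = ne ne[symmetric]
  have "(\<pi> \<circ> \<rho> \<circ> \<pi>' \<circ> \<rho>') x = (transpose a d \<circ> transpose b c) x \<and>
     (\<pi> \<circ> \<rho>' \<circ> \<pi>' \<circ> \<rho>) x = (transpose a b \<circ> transpose c d) x \<and>
     (\<pi>' \<circ> \<rho> \<circ> \<pi> \<circ> \<rho>') x = (transpose a c \<circ> transpose b d) x" for x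
  proof -
    consider "x = a" | "x = b" | "x = c" | "x = d" | "x \<notin> {a, b, c, d}" by blast
    then show ?thesis
      unfolding \<pi>_def \<pi>'_def \<rho>_def \<rho>'_def
      by cases (simp_all add: transpose_def ne)
  qed
  then show "\<pi> \<circ> \<rho> \<circ> \<pi>' \<circ> \<rho>' = transpose a d \<circ> transpose b c"
    "\<pi> \<circ> \<rho>' \<circ> \<pi>' \<circ> \<rho> = transpose a b \<circ> transpose c d"
    "\<pi>' \<circ> \<rho> \<circ> \<pi> \<circ> \<rho>' = transpose a c \<circ> transpose b d"
    by (simp_all add: fun_eq_iff)
qed

lemma transpose_inv_comp: "inv' (transpose a b \<circ> transpose c d) = transpose c d \<circ> transpose a b"
  by (simp add: o_inv_distrib)

lemma double_transposition_commute:
  assumes "distinct [a, b, c, d]"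
  shows "transpose a b \<circ> transpose c d = transpose c d \<circ> transpose a b"
  using assms by (auto simp: fun_eq_iff transpose_def)

text \<open>An involution equals its cube, so the cube in \<open>localize\<close> loses nothing
  here.\<close>

lemma double_transposition_cube:
  assumes "distinct [a, b, c, d]"
  defines "K \<equiv> transpose a b \<circ> transpose c d"
  shows "K \<circ> K \<circ> K = K"
  using assms(1) unfolding K_def by (auto simp: fun_eq_iff transpose_def)

section \<open>Five-cycles from two double transpositions\<close>

context
  fixes a p q r z :: 'a
  assumes dist: "distinct [a, p, q, r, z]"
begin

lemma five_distinct:
  "a \<noteq> p" "a \<noteq> q" "a \<noteq> r" "a \<noteq> z" "p \<noteq> q" "p \<noteq> r" "p \<noteq> z" "q \<noteq> r" "q \<noteq> z" "r \<noteq> z"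
  using dist by auto

lemmas five_ne = five_distinct five_distinct[symmetric]

text \<open>\<open>\<pi> \<circ> \<rho>\<close> is the five-cycle \<open>(a p q z r)\<close>, and \<open>K\<close> is its square.\<close>

lemma five_cycle_power:
  defines "\<pi> \<equiv> transpose a p \<circ> transpose q r" and "\<rho> \<equiv> transpose p r \<circ> transpose q z"
  defines "K \<equiv> \<pi> \<circ> \<rho> \<circ> inv' \<pi> \<circ> inv' \<rho>"
  shows "K \<circ> K \<circ> K = \<pi> \<circ> \<rho>"
proof -
  have inv: "inv' \<pi> = \<pi>" "inv' \<rho> = \<rho>"
    unfolding \<pi>_def \<rho>_def transpose_inv_comp
    by (rule double_transposition_commute; use dist in auto)+
  define c where "c = \<pi> \<circ> \<rho>"
  have c: "c a = p" "c p = q" "c q = z" "c z = r" "c r = a" "x \<notin> {a, p, q, r, z} \<Longrightarrow> c x = x" for x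
    by (simp_all add: c_def \<pi>_def \<rho>_def transpose_def five_ne)
  \<comment> \<open>Both factors are involutions. As \<open>c\<close> has order five, the cube of
    its square is \<open>c\<close> again.\<close>
  have K: "K = c \<circ> c" by (simp add: K_def inv c_def comp_assoc)
  have "(K \<circ> K \<circ> K) x = c x" for x
  proof -
    consider "x = a" | "x = p" | "x = q" | "x = r" | "x = z" | "x \<notin> {a, p, q, r, z}" by blast
    then show ?thesis unfolding K by cases (simp_all add: c)
  qed
  then show ?thesis by (simp add: fun_eq_iff c_def)
qed

text \<open>This links the transposition of the ends \<open>a\<close> and \<open>z\<close> to one
  between inner points; the two five-cycles differ by exchanging \<open>q\<close> and
  \<open>r\<close>.\<close>

lemma five_cycle_quotient:
  "(transpose a p \<circ> transpose q r \<circ> (transpose p r \<circ> transpose q z)) \<circ>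
   inv' (transpose a p \<circ> transpose r q \<circ> (transpose p q \<circ> transpose r z)) =
   transpose a z \<circ> transpose q r" (is "?l = ?r")
proof
  fix x
  have inv: "inv' (transpose a p \<circ> transpose r q \<circ> (transpose p q \<circ> transpose r z)) =
    transpose r z \<circ> transpose p q \<circ> (transpose r q \<circ> transpose a p)"
    by (simp add: o_inv_distrib bij_comp)
  consider "x = a" | "x = p" | "x = q" | "x = r" | "x = z" | "x \<notin> {a, p, q, r, z}" by blast
  then show "?l x = ?r x" unfolding inv by cases (simp_all add: transpose_def five_ne)
qed

text \<open>\<open>c\<close> maps \<open>p\<close>, \<open>q\<close>, \<open>r\<close> to
  \<open>q\<close>, \<open>z\<close>, \<open>a\<close>, and conjugation by \<open>c\<close> renames
  the points accordingly.\<close>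

lemma five_cycle_conjugate:
  defines "c \<equiv> transpose a p \<circ> transpose q r \<circ> (transpose p r \<circ> transpose q z)"
  shows "c \<circ> (transpose p q \<circ> transpose q r) \<circ> inv' c = transpose q z \<circ> transpose z a"
    (is "?l = ?r")
proof
  fix x
  have inv: "inv' c = transpose q z \<circ> transpose p r \<circ> (transpose q r \<circ> transpose a p)"
    by (simp add: c_def o_inv_distrib bij_comp)
  consider "x = a" | "x = p" | "x = q" | "x = r" | "x = z" | "x \<notin> {a, p, q, r, z}" by blast
  then show "?l x = ?r x" unfolding inv unfolding c_def by cases (simp_all add: transpose_def five_ne)
qed

end

text \<open>That the product of two transpositions lies in \<open>N\<close> is a symmetric and
  transitive relation between them, so it suffices to relate each one to that of \<open>a\<close>
  and \<open>z\<close>. Quotients of five-cycles do this for transpositions inside \<open>M\<close>,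
  conjugates of three-cycles for those joining \<open>M\<close> to an end. The condition on
  \<open>M\<close> amounts to three elements.\<close>

lemma generate_from_five_cycles:
  fixes N :: "('a \<Rightarrow> 'a) set"
  assumes comp: "\<And>g h. g \<in> N \<Longrightarrow> h \<in> N \<Longrightarrow> g \<circ> h \<in> N"
    and inv: "\<And>g. g \<in> N \<Longrightarrow> inv' g \<in> N"
    and az: "a \<notin> M" "z \<notin> M" "a \<noteq> z" and M: "\<And>p q. \<exists>r\<in>M. r \<noteq> p \<and> r \<noteq> q"
    and N: "\<And>p q r. p \<in> M \<Longrightarrow> q \<in> M \<Longrightarrow> r \<in> M \<Longrightarrow> distinct [p, q, r] \<Longrightarrow>
      transpose a p \<circ> transpose q r \<circ> (transpose p r \<circ> transpose q z) \<in> N"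
    and ab: "s \<in> insert a (insert z M)" "t \<in> insert a (insert z M)" "s \<noteq> t"
    and cd: "u \<in> insert a (insert z M)" "v \<in> insert a (insert z M)" "u \<noteq> v"
  shows "transpose s t \<circ> transpose u v \<in> N"
proof -
  have sym: "transpose s' t' \<circ> transpose u' v' \<in> N"
    if "transpose u' v' \<circ> transpose s' t' \<in> N" for s' t' u' v' :: 'a
    using inv[OF that] by (simp add: transpose_inv_comp)
  have trans: "transpose s' t' \<circ> transpose u' v' \<in> N"
    if "transpose x y \<circ> transpose s' t' \<in> N" "transpose x y \<circ> transpose u' v' \<in> N" for x y s' t' u' v' :: 'a
  proof -
    have "transpose s' t' \<circ> transpose u' v' =
      (transpose s' t' \<circ> transpose x y) \<circ> (transpose x y \<circ> transpose u' v')"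
      by (simp add: fun_eq_iff)
    then show ?thesis using comp[OF sym[OF that(1)] that(2)] by simp
  qed
  have d: "distinct [a, p, q, r, z]" if "p \<in> M" "q \<in> M" "r \<in> M" "distinct [p, q, r]" for p q r
    using that az by auto
  have 1: "transpose a z \<circ> transpose q r \<in> N" if qr: "q \<in> M" "r \<in> M" "q \<noteq> r" for q r
  proof -
    obtain p where p: "p \<in> M" "p \<noteq> q" "p \<noteq> r" using M by blast
    have "distinct [a, p, q, r, z]" using d p qr by auto
    from five_cycle_quotient[OF this] show ?thesis
      using comp[OF N[of p q r] inv[OF N[of p r q]]] p qr by auto
  qed
  have 2: "transpose q z \<circ> transpose z a \<in> N" if q: "q \<in> M" for q
  proof -
    obtain p where p: "p \<in> M" "p \<noteq> q" using M by blast
    obtain r where r: "r \<in> M" "r \<noteq> q" "r \<noteq> p" using M by blast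
    have c: "distinct [a, p, q, r, z]" using d p q r by auto
    have "transpose p q \<circ> transpose q r \<in> N" by (rule trans[of a z]) (use 1 p q r in auto)
    then show ?thesis unfolding five_cycle_conjugate[OF c, symmetric]
      using comp inv N p q r by auto
  qed
  have 3: "transpose a z \<circ> transpose q z \<in> N" if "q \<in> M" for q
    using sym[OF 2[OF that]] by (simp add: transpose_commute)
  have 4: "transpose a z \<circ> transpose q a \<in> N" if q: "q \<in> M" for q
  proof -
    have "transpose z a \<circ> transpose a q = transpose q z \<circ> transpose z a"
      using az q by (auto simp: fun_eq_iff transpose_def)
    then show ?thesis using 2[OF q] by (simp add: transpose_commute)
  qed
  obtain p where p: "p \<in> M" using M by blast
  have "transpose a z \<circ> transpose a z \<in> N" using comp[OF 3[OF p] sym[OF 3[OF p]]]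
    by (simp add: fun_eq_iff comp_def)
  moreover have "transpose a z \<circ> transpose x y \<in> N"
    if "x \<in> insert a (insert z M)" "y \<in> M" "x \<noteq> y" for x y
    using that 1[of x y] 3[of y] 4[of y] by (auto simp: transpose_commute[of y])
  ultimately have 5: "transpose a z \<circ> transpose x y \<in> N"
    if "x \<in> insert a (insert z M)" "y \<in> insert a (insert z M)" "x \<noteq> y" for x y
    using that transpose_commute[of x y] by (metis insertE)
  show ?thesis by (rule trans[OF 5[OF ab] 5[OF cd]])
qed

section \<open>The toggles generate the symmetric group\<close>

context snake
begin

text \<open>The three-cycles on the first three and on the last three vertices have double
  transpositions as commutators; \<open>localize\<close> carries these to the segment of four
  vertices.\<close>

lemma double_transpositions_seg_3:
  assumes m: "i + 3 \<le> m" and abcd: "a \<in> seg i 3" "b \<in> seg i 3" "c \<in> seg i 3" "d \<in> seg i 3" "distinct [a, b, c, d]"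
  shows "transpose a b \<circ> transpose c d \<in> localized (seg i 3)"
proof -
  let ?N = "localized (seg i 3)"
  define e0 e1 e2 e3 where e: "e0 = f i" "e1 = f (Suc i)" "e2 = f (i + 2)" "e3 = f (i + 3)"
  have dist: "distinct [e0, e1, e2, e3]" using m by (auto simp: e)
  then have dist': "distinct [e0, e3, e1, e2]" "distinct [e0, e2, e1, e3]" by auto
  have "{i..i+3} = {i, Suc i, i + 2, i + 3}" by auto
  then have seg: "seg i 3 = {e0, e1, e2, e3}" by (simp add: e)
  let ?p = "transpose e1 e2 \<circ> transpose e0 e1" and ?r = "transpose e2 e3 \<circ> transpose e1 e2"
  let ?p' = "transpose e0 e1 \<circ> transpose e1 e2" and ?r' = "transpose e1 e2 \<circ> transpose e2 e3"
  have p: "?p \<in> localized (seg i 2)" using three_cycle[of i] m by (simp add: e)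
  have r: "?r \<in> localized (seg (Suc i) 2)" using three_cycle[of "Suc i"] m by (simp add: e eval_nat_numeral)
  have p': "?p' \<in> localized (seg i 2)" using localized_inv[OF _ _ p] m by (simp add: transpose_inv_comp)
  have r': "?r' \<in> localized (seg (Suc i) 2)" using localized_inv[OF _ _ r] m by (simp add: transpose_inv_comp)
  have 3: "i + Suc 2 \<le> m" "Suc 2 = 3" using m by simp_all
  note loc = localize[OF 3(1) order_refl, unfolded 3(2)]
  \<comment> \<open>One permutation in eight notations, so that every order of the four points is
    covered at the end.\<close>
  have var: "transpose a b \<circ> transpose c d \<in> ?N \<and> transpose b a \<circ> transpose c d \<in> ?N \<and>
      transpose a b \<circ> transpose d c \<in> ?N \<and> transpose b a \<circ> transpose d c \<in> ?N \<and>
      transpose c d \<circ> transpose a b \<in> ?N \<and> transpose d c \<circ> transpose a b \<in> ?N \<and>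
      transpose c d \<circ> transpose b a \<in> ?N \<and> transpose d c \<circ> transpose b a \<in> ?N"
    if "transpose a b \<circ> transpose c d \<in> ?N" "distinct [a, b, c, d]" for a b c d
    using that double_transposition_commute[OF that(2)] by (simp add: transpose_commute)
  have "transpose e0 e3 \<circ> transpose e1 e2 \<in> ?N" "transpose e0 e1 \<circ> transpose e2 e3 \<in> ?N"
    "transpose e0 e2 \<circ> transpose e1 e3 \<in> ?N"
    using loc[OF p r] loc[OF p r'] loc[OF p' r]
    unfolding transpose_inv_comp commutator_three_cycles[OF dist]
      double_transposition_cube[OF dist] double_transposition_cube[OF dist'(1)]
      double_transposition_cube[OF dist'(2)] .
  note V = this(1)[THEN var[OF _ dist'(1)]] this(2)[THEN var[OF _ dist]] this(3)[THEN var[OF _ dist'(2)]]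
  show ?thesis using abcd V unfolding seg by (elim insertE emptyE) simp_all
qed

text \<open>\<open>localize\<close> turns double transpositions of the two shorter segments into
  five-cycles through both ends and three points of the overlap, and these generate all products of
  two transpositions. The overlap has \<open>L\<close> vertices, so \<open>L \<ge> 3\<close>
  supplies the three points.\<close>

lemma transpositions_step:
  assumes m: "i + Suc L \<le> m" and L: "L \<ge> 3"
    and U: "\<And>a b c d. a \<in> seg i L \<Longrightarrow> b \<in> seg i L \<Longrightarrow> c \<in> seg i L \<Longrightarrow> d \<in> seg i L \<Longrightarrow>
      distinct [a, b, c, d] \<Longrightarrow> transpose a b \<circ> transpose c d \<in> localized (seg i L)"
    and V: "\<And>a b c d. a \<in> seg (Suc i) L \<Longrightarrow> b \<in> seg (Suc i) L \<Longrightarrow> c \<in> seg (Suc i) L \<Longrightarrow> d \<in> seg (Suc i) L \<Longrightarrow>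
      distinct [a, b, c, d] \<Longrightarrow> transpose a b \<circ> transpose c d \<in> localized (seg (Suc i) L)"
    and st: "s \<in> seg i (Suc L)" "t \<in> seg i (Suc L)" "s \<noteq> t"
    and uv: "u \<in> seg i (Suc L)" "v \<in> seg i (Suc L)" "u \<noteq> v"
  shows "transpose s t \<circ> transpose u v \<in> localized (seg i (Suc L))"
proof -
  let ?M = "seg (Suc i) (L - 1)" and ?a = "f i" and ?z = "f (Suc (i + L))"
  have "{i..i + Suc L} = insert i (insert (Suc (i + L)) {Suc i..Suc i + (L - 1)})" using L by auto
  then have seg: "seg i (Suc L) = insert ?a (insert ?z ?M)" by simp
  have MU: "?M \<subseteq> seg i L" "?M \<subseteq> seg (Suc i) L" "?a \<in> seg i L" "?z \<in> seg (Suc i) L"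
    using L by auto
  have L2: "2 \<le> L" and mW: "2 \<le> Suc L" using L by simp_all
  have az: "?a \<notin> ?M" "?z \<notin> ?M" "?a \<noteq> ?z" using m L by auto
  have M3: "\<exists>r\<in>?M. r \<noteq> p \<and> r \<noteq> q" for p q
  proof -
    have "f (Suc i) \<in> ?M" "f (i + 2) \<in> ?M" "f (i + 3) \<in> ?M" using L by auto
    moreover have "distinct [f (Suc i), f (i + 2), f (i + 3)]" using m L by auto
    ultimately show ?thesis by (metis distinct_length_2_or_more)
  qed
  have N: "transpose ?a p \<circ> transpose q r \<circ> (transpose p r \<circ> transpose q ?z) \<in> localized (seg i (Suc L))"
    if pqr: "p \<in> ?M" "q \<in> ?M" "r \<in> ?M" "distinct [p, q, r]" for p q r
  proof -
    let ?p = "transpose ?a p \<circ> transpose q r" and ?r = "transpose p r \<circ> transpose q ?z"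
    have "{p, q, r} \<subseteq> ?M" using pqr(1-3) by (simp only: insert_subset empty_subsetI simp_thms)
    note pM = contra_subsetD[OF this az(1)] contra_subsetD[OF this az(2)]
    then have d: "distinct [?a, p, q, r, ?z]" "distinct [?a, p, q, r]" "distinct [p, r, q, ?z]"
      using pqr(4) az(3) by auto
    note u = subsetD[OF MU(1)] and v = subsetD[OF MU(2)]
    have "?p \<in> localized (seg i L)"
      by (rule U[OF MU(3) u[OF pqr(1)] u[OF pqr(2)] u[OF pqr(3)] d(2)])
    moreover have "?r \<in> localized (seg (Suc i) L)"
      by (rule V[OF v[OF pqr(1)] v[OF pqr(3)] v[OF pqr(2)] MU(4) d(3)])
    ultimately show ?thesis
      using localize[OF m L2, of ?p ?r] unfolding five_cycle_power[OF d(1)] by blast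
  qed
  show ?thesis
    by (rule generate_from_five_cycles[OF localized_comp[OF m mW] localized_inv[OF m mW] az M3 N
          st[unfolded seg] uv[unfolded seg]])
qed

text \<open>The induction is restricted to four distinct points because the base case provides only
  these products.\<close>

lemma double_transpositions_seg:
  assumes "3 \<le> L"
  shows "\<lbrakk>i + L \<le> m; a \<in> seg i L; b \<in> seg i L; c \<in> seg i L; d \<in> seg i L; distinct [a, b, c, d]\<rbrakk>
    \<Longrightarrow> transpose a b \<circ> transpose c d \<in> localized (seg i L)"
  using assms
proof (induction L arbitrary: i a b c d rule: dec_induct)
  case base
  then show ?case by (intro double_transpositions_seg_3)
next
  case (step L)
  have m: "i + L \<le> m" "Suc i + L \<le> m" using step.prems(1) by auto
  have "a \<noteq> b" "c \<noteq> d" using step.prems(6) by auto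
  from transpositions_step[OF step.prems(1) step.hyps(1) step.IH[OF m(1)] step.IH[OF m(2)]
      step.prems(2,3) this(1) step.prems(4,5) this(2)]
  show ?case .
qed

section \<open>Parity on the whole path\<close>

lemma X_eq_seg: "X = seg 0 m"
  by (simp add: X_def atMost_atLeast0)

text \<open>By \<open>segment_invariant\<close>, a path with at least three vertices has no
  translate inside itself other than the trivial one.\<close>

lemma spread_X:
  assumes "m \<ge> 2" "\<pi> permutes X"
  shows "spread X \<pi> = \<pi>"
proof
  fix y
  have occ: "S = {}" if "S \<in> occ X" for S
  proof (rule ccontr)
    assume "S \<noteq> {}"
    then have "m = Suc 0"
      using segment_invariant(1)[of 0 m S] that by (auto simp: occ_def X_def atMost_atLeast0)
    then show False using assms(1) by simp
  qed
  show "spread X \<pi> y = \<pi> y"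
  proof (cases "y \<in> X")
    case True
    have "{} \<in> occ X" by (simp add: occ_def)
    then show ?thesis using spread_eq[of 0 m "{}" y \<pi>] assms(1) True by (simp add: X_eq_seg)
  next
    case False
    then have "spread X \<pi> y = y" by (intro spread_other) (use occ in force)
    then show ?thesis using False assms(2) by (simp add: permutes_not_in)
  qed
qed

lemma even_in_toggle_group:
  assumes m: "m \<ge> 4" and st: "s \<in> X" "t \<in> X" "s \<noteq> t" and uv: "u \<in> X" "v \<in> X" "u \<noteq> v"
  shows "transpose s t \<circ> transpose u v \<in> toggle_group"
proof -
  \<comment> \<open>The last step of the induction is repeated by hand, since
    \<open>transpositions_step\<close> also yields products of transpositions that share
    points.\<close>
  let ?L = "m - 1"
  have L: "3 \<le> ?L" and X: "X = seg 0 (Suc ?L)" using m by (simp_all add: X_eq_seg)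
  have "transpose s t \<circ> transpose u v \<in> localized X"
    unfolding X
    by (rule transpositions_step[OF _ L double_transpositions_seg[OF L] double_transpositions_seg[OF L]])
      (use m st uv X in auto)
  then show ?thesis using m by (auto simp: localized_def spread_X)
qed

text \<open>
  Cutting the path down to its first \<open>j\<close> edges turns the toggle into a partial product of
  transpositions, whose parity is read off from \<open>f 0\<close> and \<open>f j\<close>.
\<close>

lemma toggle_prefix:
  assumes "j \<le> m" "m \<ge> 4"
  shows "if c \<in> f 0 \<triangle> f j then \<forall>s\<in>X. \<forall>t\<in>X. s \<noteq> t \<longrightarrow> toggle (f ` {..j}) c \<circ> transpose s t \<in> toggle_group
    else toggle (f ` {..j}) c \<in> toggle_group"
  using assms(1)
proof (induction j)
  case 0
  have "toggle (f ` {..0}) c = id" by (auto simp: toggle_def fun_eq_iff)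
  then show ?case by (simp add: toggle_group.id)
next
  case (Suc j)
  define g where "g j = toggle (f ` {..j}) c" for j
  define T where "T = transpose (f j) (f (Suc j))"
  obtain d where d: "f j \<triangle> f (Suc j) = {d}" using step[of j] Suc.prems by auto
  have dj: "f (Suc j) = f j \<triangle> {d}" "f j = f (Suc j) \<triangle> {d}"
    using d by (metis xor_cancel(4), metis xor_ac(2) xor_cancel(4))
  \<comment> \<open>The new edge has direction \<open>d\<close>, so the parity for \<open>c\<close>
    changes exactly if \<open>c = d\<close>.\<close>
  have mem: "c \<in> f 0 \<triangle> f (Suc j) \<longleftrightarrow> (c \<in> f 0 \<triangle> f j) \<noteq> (c = d)"
    unfolding dj(1) by (auto simp: xor_def)
  have tog: "toggle Y c x = (if x \<in> Y \<and> x \<triangle> {c} \<in> Y then x \<triangle> {c} else x)" for Y x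
    by (auto simp: toggle_def xor_def)
  have at: "{..Suc j} = insert (Suc j) {..j}" by auto
  have new: "f (Suc j) \<notin> f ` {..j}" using Suc.prems by auto
  have nbr: "k = j \<and> c = d" if k: "k \<le> j" "f k \<triangle> {c} = f (Suc j) \<or> f (Suc j) \<triangle> {c} = f k" for k
  proof -
    have e: "f k \<triangle> f (Suc j) = {c}" using k(2) by (metis xor_ac(2) xor_cancel(4))
    then have "k = j" using chordless[OF _ Suc.prems e] k(1) Suc.prems by simp
    then show ?thesis using e d by simp
  qed
  have IH: "if c \<in> f 0 \<triangle> f j then \<forall>s\<in>X. \<forall>t\<in>X. s \<noteq> t \<longrightarrow> g j \<circ> transpose s t \<in> toggle_group else g j \<in> toggle_group"
    using Suc unfolding g_def by simp
  have X: "f j \<in> X" "f (Suc j) \<in> X" "f j \<noteq> f (Suc j)" using Suc.prems f_in_X by auto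
  show ?case
  proof (cases "c = d")
    case True
    have up: "f j \<triangle> {c} = f (Suc j)" "f (Suc j) \<triangle> {c} = f j" using dj True by simp_all
    \<comment> \<open>The shorter toggle fixes both ends of the new edge, as
      \<open>f (Suc j)\<close> lies outside the prefix.\<close>
    have "g (Suc j) x = (g j \<circ> T) x" for x
    proof -
      consider "x = f j" | "x = f (Suc j)" | "x \<noteq> f j" "x \<noteq> f (Suc j)" by blast
      then show ?thesis
      proof cases
        case 1
        then show ?thesis using new up by (simp add: g_def tog T_def at)
      next
        case 2
        then show ?thesis using new up X by (simp add: g_def tog T_def at)
      next
        case 3
        have "x \<triangle> {c} \<noteq> f (Suc j)" using 3(1) up by (metis xor_cancel(5))
        then show ?thesis using 3 by (simp add: g_def tog T_def at)
      qed
    qed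
    then have g: "g (Suc j) = g j \<circ> T" by (simp add: fun_eq_iff)
    show ?thesis
    proof (cases "c \<in> f 0 \<triangle> f j")
      case odd: True
      then have "g (Suc j) \<in> toggle_group" using IH X unfolding g T_def by auto
      then show ?thesis using mem True odd by (simp add: g_def)
    next
      case even: False
      then have "g j \<in> toggle_group" using IH by simp
      \<comment> \<open>\<open>T\<close> followed or preceded by one more transposition is even,
        hence available.\<close>
      then have "g (Suc j) \<circ> transpose s t \<in> toggle_group" if "s \<in> X" "t \<in> X" "s \<noteq> t" for s t
        unfolding g T_def comp_assoc using even_in_toggle_group[OF assms(2) X that] by (rule toggle_group_comp)
      then show ?thesis using mem True even by (simp add: g_def)
    qed
  next
    case False
    have "g (Suc j) x = g j x" for x
    proof (cases "x = f (Suc j)")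
      case True
      have "f (Suc j) \<triangle> {c} \<noteq> f (Suc j)" by (auto simp: xor_def)
      then show ?thesis using True nbr False new by (auto simp: g_def tog at)
    next
      case nx: False
      have "x \<triangle> {c} \<noteq> f (Suc j)" if "x \<in> f ` {..j}" using that nbr False by blast
      then show ?thesis using nx by (auto simp: g_def tog at)
    qed
    then have "g (Suc j) = g j" by (simp add: fun_eq_iff)
    moreover have "c \<in> f 0 \<triangle> f (Suc j) \<longleftrightarrow> c \<in> f 0 \<triangle> f j" using mem False by blast
    ultimately show ?thesis unfolding g_def[symmetric] using IH by (simp only:)
  qed
qed

text \<open>With at most three edges no direction repeats: a repetition could only occur on the
  first and third edge, and then \<open>f 0\<close> and \<open>f 3\<close> would differ in the
  middle direction alone, a chord. So the toggle of an edge is its transposition.\<close>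

lemma adjacent_transpositions_in_toggle_group:
  assumes "m \<le> 3" "j < m"
  shows "transpose (f j) (f (Suc j)) \<in> toggle_group"
proof -
  obtain c where c: "f j \<triangle> f (Suc j) = {c}" using step assms(2) by blast
  have up: "f j \<triangle> {c} = f (Suc j)" "f (Suc j) \<triangle> {c} = f j"
    using c by (metis xor_cancel(4), metis xor_ac(2) xor_cancel(4))
  have away: "\<not> (x \<in> X \<and> x \<triangle> {c} \<in> X)" if x: "x \<noteq> f j" "x \<noteq> f (Suc j)" for x
  proof
    assume "x \<in> X \<and> x \<triangle> {c} \<in> X"
    then obtain p q where pq: "p \<le> m" "q \<le> m" "x = f p" "x \<triangle> {c} = f q" by (auto simp: X_def)
    then have e: "f p \<triangle> f q = {c}" by (metis xor_cancel(4))
    then have adj: "q = Suc p \<or> p = Suc q" using chordless pq by blast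
    have n: "p \<noteq> j" "p \<noteq> Suc j" "q \<noteq> j" "q \<noteq> Suc j"
      using x pq(3,4) up by (metis xor_cancel(5))+
    have "(j = 0 \<and> (p = 2 \<and> q = 3 \<or> p = 3 \<and> q = 2)) \<or> (j = 2 \<and> (p = 0 \<and> q = 1 \<or> p = 1 \<and> q = 0))"
      using adj n pq(1,2) assms by presburger
    note cases = this
    then have m3: "m = 3" using pq(1,2) assms by (elim disjE conjE) simp_all
    have "f q \<triangle> f p = {c}" using e by (metis xor_ac(2))
    then have cc: "f 0 \<triangle> f (Suc 0) = {c}" "f 2 \<triangle> f 3 = {c}"
      using cases c e by (elim disjE conjE, simp_all)+
    obtain d where d: "f (Suc 0) \<triangle> f 2 = {d}" using step[of "Suc 0"] m3 by (auto simp: numeral_2_eq_2)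
    have "f 0 \<triangle> f 3 = (f 0 \<triangle> f (Suc 0)) \<triangle> (f (Suc 0) \<triangle> f 2) \<triangle> (f 2 \<triangle> f 3)"
      by (auto simp: xor_def)
    then have "f 0 \<triangle> f 3 = {d}" unfolding cc d by (simp add: xor_ac)
    then show False using chordless[of 0 3 d] m3 by simp
  qed
  have "transpose (f j) (f (Suc j)) = toggle X c"
  proof
    fix x
    have X: "f j \<in> X" "f (Suc j) \<in> X" using assms(2) f_in_X by auto
    show "transpose (f j) (f (Suc j)) x = toggle X c x"
      using up X away[of x] by (auto simp: toggle_eq transpose_def)
  qed
  then show ?thesis using toggle_in_toggle_group by simp
qed

text \<open>For \<open>m \<ge> 4\<close>, an element \<open>c\<close> in which the two ends of the
  path differ has an odd toggle; by \<open>toggle_prefix\<close> its product with any transposition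
  is available, and the toggle cancels. Shorter paths are handled by adjacent
  transpositions.\<close>

lemma transpositions_in_toggle_group:
  assumes "s \<in> X" "t \<in> X"
  shows "transpose s t \<in> toggle_group"
proof (cases "m \<ge> 4")
  case m: True
  have "f 0 \<triangle> f m \<noteq> {}" using m by simp
  then obtain c where "c \<in> f 0 \<triangle> f m" by blast
  then have T: "toggle X c \<circ> transpose s t \<in> toggle_group" if "s \<in> X" "t \<in> X" "s \<noteq> t" for s t
    using toggle_prefix[of m c, folded X_def] m that by simp
  show ?thesis
  proof (cases "s = t")
    case False
    have "toggle X c \<circ> (toggle X c \<circ> transpose s t) \<in> toggle_group"
      by (intro toggle_group.toggle T assms False)
    then show ?thesis by (simp add: toggle_toggle flip: comp_assoc)
  qed (simp add: toggle_group.id)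
next
  case False
  \<comment> \<open>Induction on the distance \<open>k\<close>, conjugating with the adjacent
    transposition at the far end.\<close>
  have le: "transpose (f p) (f (p + k)) \<in> toggle_group" if "p + k \<le> m" for p k
    using that
  proof (induction k)
    case (Suc k)
    show ?case
    proof (cases "k = 0")
      case True
      then show ?thesis using adjacent_transpositions_in_toggle_group[of p] Suc.prems False by simp
    next
      case k: False
      let ?T = "transpose (f (p + k)) (f (Suc (p + k)))"
      have "?T \<in> toggle_group" using adjacent_transpositions_in_toggle_group[of "p + k"] Suc.prems False by simp
      moreover have "transpose (f p) (f (p + k)) \<in> toggle_group" using Suc by simp
      ultimately have "?T \<circ> transpose (f p) (f (p + k)) \<circ> ?T \<in> toggle_group" by (intro toggle_group_comp)
      moreover have "?T \<circ> transpose (f p) (f (p + k)) \<circ> ?T = transpose (f p) (f (Suc (p + k)))"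
        using Suc.prems k by (auto simp: fun_eq_iff transpose_def)
      ultimately show ?thesis by simp
    qed
  qed (simp add: toggle_group.id)
  obtain p q where pq: "p \<le> m" "q \<le> m" "s = f p" "t = f q" using assms by (auto simp: X_def)
  show ?thesis
  proof (cases "p \<le> q")
    case True
    then show ?thesis using le[of p "q - p"] pq by simp
  next
    case False
    then show ?thesis using le[of q "p - q"] pq by (simp add: transpose_commute)
  qed
qed

theorem toggles_generate_symmetric_group:
  assumes "p permutes X"
  shows "p \<in> toggle_group"
proof -
  have "finite X" by (simp add: X_def)
  with assms show ?thesis
  proof (induction rule: permutes_induct)
    case id
    show ?case by (rule toggle_group.id)
  next
    case (swap a b p)
    show ?case by (intro toggle_group_comp transpositions_in_toggle_group swap)
  qed
qed

end

section \<open>The coloring group\<close>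

lemma sym_on_iso_sym_group:
  assumes "finite V"
  shows "sym_on V \<cong> sym_group (card V)"
proof -
  obtain h where h: "bij_betw h V {1..card V}"
    using ex_bij_betw_nat_finite_1[OF assms] bij_betw_inv by blast
  let ?h = "map_permutation V h" and ?g = "map_permutation {1..card V} (inv_into V h)"
  have inj: "inj_on h V" using h by (rule bij_betw_imp_inj_on)
  have inv: "bij_betw (inv_into V h) {1..card V} V" using h by (rule bij_betw_inv_into)
  have "?h \<in> hom (sym_on V) (sym_on {1..card V})"
    using map_permutation_permutes[OF h] map_permutation_compose'[OF inj]
    by (auto simp: hom_def sym_on_def)
  moreover have "bij_betw ?h {p. p permutes V} {p. p permutes {1..card V}}"
  proof (rule bij_betw_byWitness[where f' = ?g])
    show "\<forall>p\<in>{p. p permutes V}. ?g (?h p) = p"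
      using map_permutation_compose_inv[OF h] inj by auto
    show "\<forall>p\<in>{p. p permutes {1..card V}}. ?h (?g p) = p"
      using map_permutation_compose_inv[OF inv] h by (auto simp: bij_betw_inv_into_right)
  qed (use map_permutation_permutes[OF h] map_permutation_permutes[OF inv] in auto)
  ultimately have "?h \<in> iso (sym_on V) (sym_on {1..card V})"
    by (simp add: iso_def sym_on_def)
  then show ?thesis unfolding sym_on_sym_group by (rule is_isoI)
qed

text \<open>\<open>\<phi>\<close> carries the graph to an induced path of the cube and each
  \<open>tau E \<kappa> a\<close> to the toggle of \<open>c a\<close>; the result is then read off
  from \<open>toggles_generate_symmetric_group\<close>.\<close>

theorem coloring_group_eq_sym_on:
  assumes G: "path_graph V E n" and \<kappa>: "proper_edge_coloring E k \<kappa>"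
    and T: "generalized_toggle_group TYPE('e) V E k \<kappa>"
  shows "coloring_group V E k \<kappa> = sym_on V"
proof -
  let ?C = "generate (sym_on V) (tau E \<kappa> ` {1..k})"
  obtain vs where vs: "vs \<noteq> []" "length vs = n" "distinct vs" "set vs = V"
    and E: "E = {{vs ! i, vs ! Suc i} | i. Suc i < n}"
    using G unfolding path_graph_def by blast
  obtain S :: "'e set" and L \<phi> c where LS: "L \<subseteq> Pow S" and \<phi>: "bij_betw \<phi> V L"
    and edge': "\<forall>u\<in>V. \<forall>v\<in>V. u \<noteq> v \<longrightarrow>
      (\<forall>a\<in>{1..k}. {u, v} \<in> E \<and> \<kappa> {u, v} = a \<longleftrightarrow> sym_diff (\<phi> u) (\<phi> v) = {c a})"
    and tog: "\<forall>e\<in>S. toggle L e \<noteq> id \<longrightarrow> e \<in> c ` {1..k}"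
    using T unfolding generalized_toggle_group_def by (elim exE conjE) (rule that)
  have edge: "{u, v} \<in> E \<and> \<kappa> {u, v} = a \<longleftrightarrow> \<phi> u \<triangle> \<phi> v = {c a}"
    if "u \<in> V" "v \<in> V" "u \<noteq> v" "a \<in> {1..k}" for u v a
    unfolding xor_def by (rule edge'[rule_format, OF that])
  have inj_phi: "inj_on \<phi> V" and im: "\<phi> ` V = L" using \<phi> by (auto simp: bij_betw_def)
  have col: "\<kappa> e \<in> {1..k}" if "e \<in> E" for e
    using \<kappa> that unfolding proper_edge_coloring_def by blast
  \<comment> \<open>A direction joining two members of \<open>L\<close> has a nontrivial toggle and
    hence carries a color. This excludes chords in uncolored directions.\<close>
  have toggle_color: "\<exists>a\<in>{1..k}. e = c a" if x: "x \<in> L" "x \<triangle> {e} \<in> L" for x e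
  proof -
    have "x \<triangle> {e} \<noteq> x" by (auto simp: xor_def)
    moreover have "toggle L e x = x \<triangle> {e}" using x by (auto simp: toggle_def xor_def)
    ultimately have "toggle L e \<noteq> id" by (metis id_apply)
    moreover have "e \<in> x \<or> e \<in> x \<triangle> {e}" by (auto simp: xor_def)
    then have "e \<in> S" using x LS by blast
    ultimately show ?thesis using tog[rule_format, of e] by blast
  qed
  \<comment> \<open>\<open>m\<close> counts the edges, one less than the vertices.\<close>
  define m where "m = n - 1"
  define f where "f i = \<phi> (vs ! i)" for i
  have lt: "i < n \<longleftrightarrow> i \<le> m" for i using vs(1,2) by (cases vs) (auto simp: m_def)
  have V: "vs ! i \<in> V" if "i \<le> m" for i
    using that lt[of i] vs(2,4) nth_mem[of i vs] by simp
  have nth: "vs ! i = vs ! j \<longleftrightarrow> i = j" if "i \<le> m" "j \<le> m" for i j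
    using that lt[of i] lt[of j] vs(2,3) by (simp add: nth_eq_iff_index_eq)
  have fL: "f i \<in> L" if "i \<le> m" for i
    unfolding f_def im[symmetric] using V[OF that] by (rule imageI)
  interpret snake f m
  proof
    show "inj_on f {..m}"
    proof (rule inj_onI)
      fix i j assume "i \<in> {..m}" "j \<in> {..m}" "f i = f j"
      then show "i = j" using inj_onD[OF inj_phi _ V[of i] V[of j]] nth by (simp add: f_def)
    qed
    show "\<exists>c. f i \<triangle> f (Suc i) = {c}" if "i < m" for i
    proof -
      have "{vs ! i, vs ! Suc i} \<in> E" unfolding E using that lt[of "Suc i"] by auto
      moreover note col[OF this]
      moreover have "vs ! i \<noteq> vs ! Suc i" using nth[of i "Suc i"] that by simp
      moreover have "vs ! i \<in> V" "vs ! Suc i \<in> V" using V that by simp_all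
      ultimately have "\<phi> (vs ! i) \<triangle> \<phi> (vs ! Suc i) = {c (\<kappa> {vs ! i, vs ! Suc i})}"
        using edge by blast
      then show ?thesis unfolding f_def by blast
    qed
    show "j = Suc i \<or> i = Suc j" if ij: "i \<le> m" "j \<le> m" and e: "f i \<triangle> f j = {e}" for i j e
    proof -
      have fj: "f j = f i \<triangle> {e}" using e by (metis xor_cancel(4))
      then obtain a where a: "a \<in> {1..k}" "e = c a"
        using toggle_color[of "f i" e] fL[OF ij(1)] fL[OF ij(2)] by auto
      have "i \<noteq> j" using e by auto
      then have "vs ! i \<noteq> vs ! j" using nth[OF ij] by simp
      then have "{vs ! i, vs ! j} \<in> E"
        using edge[OF V[OF ij(1)] V[OF ij(2)] _ a(1)] e unfolding f_def a(2) by blast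
      then obtain l where l: "{vs ! i, vs ! j} = {vs ! l, vs ! Suc l}" "Suc l < n" unfolding E by blast
      have lm: "l \<le> m" "Suc l \<le> m" using lt[of l] lt[of "Suc l"] l(2) by auto
      show ?thesis using l(1) nth[OF ij(1)] nth[OF ij(2)] lm by (auto simp: doubleton_eq_iff)
    qed
  qed
  have "{..m} = {..<length vs}" using lt vs(2) by auto
  then have "V = (!) vs ` {..m}" using nth_image[of "length vs" vs] vs(4) by (simp add: atLeast0LessThan)
  then have X: "X = L" unfolding im[symmetric] by (simp add: X_def f_def image_image)
  have step: "toggle L (c a) (\<phi> v) = \<phi> (tau E \<kappa> a v)" if a: "a \<in> {1..k}" and v: "v \<in> V" for a v
  proof (cases "\<phi> v \<triangle> {c a} \<in> L")
    case True
    then obtain u where u: "u \<in> V" "\<phi> u = \<phi> v \<triangle> {c a}" using im by (metis imageE)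
    then have uv: "\<phi> v \<triangle> \<phi> u = {c a}" by simp
    then have "v \<noteq> u" by auto
    then have "{v, u} \<in> E \<and> \<kappa> {v, u} = a" using edge[OF v u(1) _ a] uv by simp
    then have "tau E \<kappa> a v = u" using tau_edge[OF G \<kappa>] by blast
    moreover have "toggle L (c a) (\<phi> v) = \<phi> v \<triangle> {c a}"
      using True v im unfolding X[symmetric] toggle_eq by auto
    ultimately show ?thesis using u by simp
  next
    case False
    have "tau E \<kappa> a v = v"
    proof (rule tau_fixed[OF G \<kappa>])
      fix e assume e: "e \<in> E" "\<kappa> e = a"
      show "v \<notin> e"
      proof
        assume "v \<in> e"
        then obtain u where u: "e = {v, u}" "u \<noteq> v" "u \<in> V"
          using path_graph_edge[OF G e(1)] by (metis doubleton_eq_iff insert_iff singletonD)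
        then have "\<phi> v \<triangle> \<phi> u = {c a}" using edge[of v u a] e v a by simp
        then have "\<phi> v \<triangle> {c a} = \<phi> u" by (metis xor_cancel(4))
        then show False using False u(3) im by auto
      qed
    qed
    moreover have "toggle L (c a) (\<phi> v) = \<phi> v" using False unfolding X[symmetric] toggle_eq by simp
    ultimately show ?thesis by simp
  qed
  have tau: "tau E \<kappa> a \<in> ?C" if "a \<in> {1..k}" for a
    using that by (intro generate.incl) simp
  have C: "p permutes V" if "p \<in> ?C" for p
    using subgroup.subset[OF coloring_group_subgroup[OF G \<kappa>]] that
    by (auto simp: coloring_group_def sym_on_def)
  have lift: "\<exists>p\<in>?C. \<forall>v\<in>V. g (\<phi> v) = \<phi> (p v)" if "g \<in> snake.toggle_group f m" for g
    using that
  proof (induction rule: toggle_group.induct)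
    case id
    have "id \<in> ?C" using generate.one[of "sym_on V"] by (simp add: sym_on_def)
    then show ?case by (intro bexI[of _ id]) auto
  next
    case (toggle g e)
    then obtain p where p: "p \<in> ?C" "\<forall>v\<in>V. g (\<phi> v) = \<phi> (p v)" by blast
    have pV: "p v \<in> V" if "v \<in> V" for v using C[OF p(1)] that by (simp add: permutes_in_image)
    show ?case
    \<comment> \<open>\<open>toggle_group\<close> admits every \<open>e\<close> of the type; one
      that joins no two members of \<open>L\<close> acts as the identity, and \<open>p\<close> is
      kept.\<close>
    proof (cases "\<exists>x\<in>L. x \<triangle> {e} \<in> L")
      case True
      then obtain a where a: "a \<in> {1..k}" "e = c a" using toggle_color by blast
      have "tau E \<kappa> a \<circ> p \<in> ?C"
        using generate.eng[OF tau[OF a(1)] p(1)] by (simp add: sym_on_def)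
      moreover have "\<forall>v\<in>V. (toggle X e \<circ> g) (\<phi> v) = \<phi> ((tau E \<kappa> a \<circ> p) v)"
        using p(2) pV step[OF a(1)] by (simp add: X a(2))
      ultimately show ?thesis by blast
    next
      case False
      then have "toggle X e = id" unfolding X[symmetric] by (auto simp: fun_eq_iff toggle_eq)
      then show ?thesis using p by auto
    qed
  qed
  have "p \<in> ?C" if p: "p permutes V" for p
  proof -
    have "map_permutation V \<phi> p permutes X" unfolding X by (rule map_permutation_permutes[OF \<phi> p])
    then have "map_permutation V \<phi> p \<in> snake.toggle_group f m" by (rule toggles_generate_symmetric_group)
    then obtain q where q: "q \<in> ?C" "\<forall>v\<in>V. map_permutation V \<phi> p (\<phi> v) = \<phi> (q v)" using lift by blast
    have "p v = q v" for v
    proof (cases "v \<in> V")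
      case True
      have "\<phi> (p v) = \<phi> (q v)"
        using q(2)[rule_format, OF True] map_permutation_apply[OF inj_phi True, of p] by simp
      moreover have "p v \<in> V" "q v \<in> V" using True p C[OF q(1)] by (simp_all add: permutes_in_image)
      ultimately show ?thesis using inj_phi by (simp add: inj_on_eq_iff)
    qed (use p C[OF q(1)] in \<open>simp add: permutes_not_in\<close>)
    then show ?thesis using q(1) by presburger
  qed
  then have "?C = {p. p permutes V}" using C by blast
  then show ?thesis by (simp add: coloring_group_def sym_on_def)
qed

theorem theorem4p5:
  fixes V :: "'v set" and E :: "'v set set" and n k :: nat and \<kappa> :: "'v set \<Rightarrow> nat"
  assumes "path_graph V E n"
    and "proper_edge_coloring E k \<kappa>"
    and "generalized_toggle_group TYPE('e) V E k \<kappa>"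
  shows "(\<exists>q d. primepow q \<and> d \<ge> 2 \<and> n = (q ^ d - 1) div (q - 1) \<and>
            (\<exists>(F :: nat ring) \<phi>. field F \<and> finite (carrier F) \<and> card (carrier F) = q \<and>
               bij_betw \<phi> V (proj_points F d) \<and>
               PGL F d \<subseteq> map_permutation V \<phi> ` carrier (coloring_group V E k \<kappa>) \<and>
               map_permutation V \<phi> ` carrier (coloring_group V E k \<kappa>) \<subseteq> PGammaL F d))
         \<or> coloring_group V E k \<kappa> \<cong> M23
         \<or> coloring_group V E k \<kappa> \<cong> sym_group n"
proof -
  have "card V = n" using assms(1) by (auto simp: path_graph_def distinct_card)
  \<comment> \<open>Only a relabelling of the vertices by the numbers from 1 to \<open>n\<close>
    remains.\<close>
  then have "coloring_group V E k \<kappa> \<cong> sym_group n"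
    using coloring_group_eq_sym_on[OF assms] sym_on_iso_sym_group path_graph_finite(1)[OF assms(1)] by metis
  then show ?thesis by blast
qed

end
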